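(* Let $(BC,D)$ be an A$_\infty$ coalgebra over a field $\Bbbk$ and let $F:(B^MC,D^M)\to(B^NC,D^N)$ be an A$_\infty$ cobimodule map whose lowest component $F_{0,0}:M\to N$ induces an isomorphism $(F_{0,0})_*:H_\bullet(M,D^M_{0,0})\to H_\bullet(N,D^N_{0,0})$. Then there exists an A$_\infty$ cobimodule map $G:(B^NC,D^N)\to(B^MC,D^M)$ such that on homology $G_*\circ F_*=\mathrm{id}_{H_\bullet(B^MC,D^M)}$ and $F_*\circ G_*=\mathrm{id}_{H_\bullet(B^NC,D^N)}$.
   Context: For a graded $\Bbbk$-module $C$, $sC$ denotes its suspension and $BC=\prod_{i\ge 0}(sC)^{\otimes i}$. An A$_\infty$ coalgebra structure on $C$ is a derivation $D$ of $BC$ of degree $+1$ with $D^2=0$. For a graded module $M$, $B^MC=\prod_{i,j\ge0}(sC)^{\otimes i}\otimes sM\otimes (sC)^{\otimes j}$. An A$_\infty$ cobimodule structure on $M$ is a degree $+1$ map $D^M$ on $B^MC$ which is a derivation over $D$ with $(D^M)^2=0$; it is determined by its restriction to $sM$, whose component into $(sC)^{\otimes i}\otimes sM\otimes(sC)^{\otimes j}$ is $D^M_{i,j}$ (so $D^M_{0,0}$ is a differential on $M$). An A$_\infty$ cobimodule map $F:(B^MC,D^M)\to(B^NC,D^N)$ is a degree-$0$ $BC$-bimodule map with $D^N F=F D^M$; it is determined by $F|_M$, whose component into $(sC)^{\otimes i}\otimes sN\otimes(sC)^{\otimes j}$ is $F_{i,j}$. $F_*$ denotes the induced map on homology of the complexes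 $(B^MC,D^M)\to(B^NC,D^N)$. *)

theory Defs
  imports Main
begin

text \<open>
  Encoding. Over a field every graded module has a homogeneous basis, so a graded
  module C is given by a basis type 'c together with the degree function degc,
  where degc c is the degree of the suspended basis element s c in sC.
  Elements of BC = prod_i (sC)^{\<otimes>i} are functions from words ('c list) to
  scalars with finite support in each tensor length; elements of
  B^M C = prod_{i,j} (sC)^{\<otimes>i} \<otimes> sM \<otimes> (sC)^{\<otimes>j} are functions on
  triples (u, m, v) with finite support for each pair of lengths (i, j).
  Structure maps are given by their restrictions to generators (as in the paper,
  a derivation / bimodule map is determined by its restriction), and extended by
  the (continuous) derivation / bimodule-map rules with Koszul signs.
\<close>

definition ksign :: "int \<Rightarrow> 'k::field" where
  "ksign e = (if even e then 1 else -1)"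

definition wdeg :: "('c \<Rightarrow> int) \<Rightarrow> 'c list \<Rightarrow> int" where
  "wdeg degc w = sum_list (map degc w)"

definition tdeg :: "('c \<Rightarrow> int) \<Rightarrow> ('m \<Rightarrow> int) \<Rightarrow> ('c list \<times> 'm \<times> 'c list) \<Rightarrow> int" where
  "tdeg degc degm t = (case t of (u, m, v) \<Rightarrow> wdeg degc u + degm m + wdeg degc v)"

definition homog :: "('a \<Rightarrow> int) \<Rightarrow> int \<Rightarrow> ('a \<Rightarrow> 'k::zero) \<Rightarrow> bool" where
  "homog deg n x = (\<forall>a. x a \<noteq> 0 \<longrightarrow> deg a = n)"

definition adm_B :: "('c list \<Rightarrow> 'k::zero) \<Rightarrow> bool" where
  "adm_B x = (\<forall>n. finite {w. length w = n \<and> x w \<noteq> 0})"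

definition adm_BM :: "('c list \<times> 'm \<times> 'c list \<Rightarrow> 'k::zero) \<Rightarrow> bool" where
  "adm_BM x = (\<forall>i j. finite {(u, m, v). length u = i \<and> length v = j \<and> x (u, m, v) \<noteq> 0})"

definition fin_supp :: "('a \<Rightarrow> 'k::zero) \<Rightarrow> bool" where
  "fin_supp x = finite {a. x a \<noteq> 0}"

text \<open>The derivation D of BC determined by d (its restriction to sC).\<close>
definition Dext :: "('c \<Rightarrow> int) \<Rightarrow> ('c \<Rightarrow> 'c list \<Rightarrow> 'k::field)
    \<Rightarrow> ('c list \<Rightarrow> 'k) \<Rightarrow> ('c list \<Rightarrow> 'k)" where
  "Dext degc d x w' =
     (\<Sum>(u, v, z) \<in> {(u, v, z). u @ v @ z = w'}.
        \<Sum>c \<in> {c. x (u @ [c] @ z) \<noteq> 0}.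
          ksign (wdeg degc u) * x (u @ [c] @ z) * d c v)"

text \<open>A(n uncurved) A-infinity coalgebra structure: components D_i : sC \<rightarrow> (sC)^{\<otimes>i},
  i \<ge> 1, of degree +1, with D^2 = 0.\<close>
definition ainf_coalg :: "('c \<Rightarrow> int) \<Rightarrow> ('c \<Rightarrow> 'c list \<Rightarrow> 'k::field) \<Rightarrow> bool" where
  "ainf_coalg degc d =
     ((\<forall>c. adm_B (d c) \<and> homog (wdeg degc) (degc c + 1) (d c) \<and> d c [] = 0) \<and>
      (\<forall>x. adm_B x \<longrightarrow> Dext degc d (Dext degc d x) = (\<lambda>_. 0)))"

text \<open>The map D^M on B^M C determined by dM (its restriction to sM), a derivation over D.\<close>
definition DMext :: "('c \<Rightarrow> int) \<Rightarrow> ('m \<Rightarrow> int) \<Rightarrow> ('c \<Rightarrow> 'c list \<Rightarrow> 'k::field)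
    \<Rightarrow> ('m \<Rightarrow> ('c list \<times> 'm \<times> 'c list) \<Rightarrow> 'k)
    \<Rightarrow> (('c list \<times> 'm \<times> 'c list) \<Rightarrow> 'k) \<Rightarrow> (('c list \<times> 'm \<times> 'c list) \<Rightarrow> 'k)" where
  "DMext degc degm d dM x t =
    (case t of (u', m', v') \<Rightarrow>
      (\<Sum>(u, v, z) \<in> {(u, v, z). u @ v @ z = u'}.
        \<Sum>c \<in> {c. x (u @ [c] @ z, m', v') \<noteq> 0}.
          ksign (wdeg degc u) * x (u @ [c] @ z, m', v') * d c v)
    + (\<Sum>(u, p) \<in> {(u, p). u @ p = u'}. \<Sum>(q, z) \<in> {(q, z). q @ z = v'}.
        \<Sum>m \<in> {m. x (u, m, z) \<noteq> 0}.
          ksign (wdeg degc u) * x (u, m, z) * dM m (p, m', q))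
    + (\<Sum>(u, v, z) \<in> {(u, v, z). u @ v @ z = v'}.
        \<Sum>c \<in> {c. x (u', m', u @ [c] @ z) \<noteq> 0}.
          ksign (wdeg degc u' + degm m' + wdeg degc u) * x (u', m', u @ [c] @ z) * d c v))"

definition ainf_cobimod :: "('c \<Rightarrow> int) \<Rightarrow> ('m \<Rightarrow> int) \<Rightarrow> ('c \<Rightarrow> 'c list \<Rightarrow> 'k::field)
    \<Rightarrow> ('m \<Rightarrow> ('c list \<times> 'm \<times> 'c list) \<Rightarrow> 'k) \<Rightarrow> bool" where
  "ainf_cobimod degc degm d dM =
     ((\<forall>m. adm_BM (dM m) \<and> homog (tdeg degc degm) (degm m + 1) (dM m)) \<and>
      (\<forall>x. adm_BM x \<longrightarrow> DMext degc degm d dM (DMext degc degm d dM x) = (\<lambda>_. 0)))"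

text \<open>The BC-bimodule map B^M C \<rightarrow> B^N C determined by f (its restriction to sM).\<close>
definition Fext :: "('m \<Rightarrow> ('c list \<times> 'n \<times> 'c list) \<Rightarrow> 'k::field)
    \<Rightarrow> (('c list \<times> 'm \<times> 'c list) \<Rightarrow> 'k) \<Rightarrow> (('c list \<times> 'n \<times> 'c list) \<Rightarrow> 'k)" where
  "Fext f x t =
    (case t of (u', n', v') \<Rightarrow>
      (\<Sum>(u, p) \<in> {(u, p). u @ p = u'}. \<Sum>(q, z) \<in> {(q, z). q @ z = v'}.
        \<Sum>m \<in> {m. x (u, m, z) \<noteq> 0}. x (u, m, z) * f m (p, n', q)))"

definition cobimod_map :: "('c \<Rightarrow> int) \<Rightarrow> ('m \<Rightarrow> int) \<Rightarrow> ('n \<Rightarrow> int)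
    \<Rightarrow> ('c \<Rightarrow> 'c list \<Rightarrow> 'k::field)
    \<Rightarrow> ('m \<Rightarrow> ('c list \<times> 'm \<times> 'c list) \<Rightarrow> 'k)
    \<Rightarrow> ('n \<Rightarrow> ('c list \<times> 'n \<times> 'c list) \<Rightarrow> 'k)
    \<Rightarrow> ('m \<Rightarrow> ('c list \<times> 'n \<times> 'c list) \<Rightarrow> 'k) \<Rightarrow> bool" where
  "cobimod_map degc degm degn d dM dN f =
     ((\<forall>m. adm_BM (f m) \<and> homog (tdeg degc degn) (degm m) (f m)) \<and>
      (\<forall>x. adm_BM x \<longrightarrow> DMext degc degn d dN (Fext f x) = Fext f (DMext degc degm d dM x)))"

definition comp00 :: "('m \<Rightarrow> ('c list \<times> 'n \<times> 'c list) \<Rightarrow> 'k::field)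
    \<Rightarrow> ('m \<Rightarrow> 'k) \<Rightarrow> ('n \<Rightarrow> 'k)" where
  "comp00 f x n' = (\<Sum>m \<in> {m. x m \<noteq> 0}. x m * f m ([], n', []))"

definition cycles :: "(('a \<Rightarrow> 'k) \<Rightarrow> bool) \<Rightarrow> ('a \<Rightarrow> int) \<Rightarrow> (('a \<Rightarrow> 'k) \<Rightarrow> ('a \<Rightarrow> 'k::field))
    \<Rightarrow> int \<Rightarrow> ('a \<Rightarrow> 'k) set" where
  "cycles A deg d n = {x. A x \<and> homog deg n x \<and> d x = (\<lambda>_. 0)}"

definition bdries :: "(('a \<Rightarrow> 'k) \<Rightarrow> bool) \<Rightarrow> ('a \<Rightarrow> int) \<Rightarrow> (('a \<Rightarrow> 'k) \<Rightarrow> ('a \<Rightarrow> 'k::field))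
    \<Rightarrow> int \<Rightarrow> ('a \<Rightarrow> 'k) set" where
  "bdries A deg d n = {d y | y. A y \<and> homog deg (n - 1) y}"

definition induces_hom_iso where
  "induces_hom_iso A1 deg1 d1 A2 deg2 d2 f =
     ((\<forall>n. \<forall>x \<in> cycles A1 deg1 d1 n. f x \<in> bdries A2 deg2 d2 n \<longrightarrow> x \<in> bdries A1 deg1 d1 n) \<and>
      (\<forall>n. \<forall>y \<in> cycles A2 deg2 d2 n. \<exists>x \<in> cycles A1 deg1 d1 n. (\<lambda>a. f x a - y a) \<in> bdries A2 deg2 d2 n))"

definition hom_comp_id where
  "hom_comp_id A deg d g f =
     (\<forall>n. \<forall>x \<in> cycles A deg d n. (\<lambda>a. g (f x) a - x a) \<in> bdries A deg d n)"

end

theory Submission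
  imports Defs "HOL.Vector_Spaces" "HOL-Library.Poly_Mapping"
begin

text \<open>
  The mapping cone of \<open>F\<close> is itself an A-infinity cobimodule \<open>K\<close> with underlying module
  \<open>M[1] \<oplus> N\<close>, and its (0,0)-complex is the cone of \<open>F\<^sub>0\<^sub>0\<close>, hence acyclic. Over a field it
  has a contraction, whose bimodule extension contracts \<open>K\<close> up to terms that strictly increase
  word length; a Neumann series in these terms corrects it to a bimodule map \<open>H\<close> with
  \<open>D H + H D = 1\<close>. The component \<open>G\<close> of \<open>H\<close> from \<open>N\<close> to \<open>M\<close> is a chain map and the diagonal
  components are homotopies from \<open>G F\<close> and \<open>F G\<close> to the identity.
\<close>

section \<open>Pairings of finitely supported functions\<close>

text \<open>Constructing \<open>G\<close> directly would mean solving for its components one word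
  length at a time and then finding homotopies for \<open>G F\<close> and \<open>F G\<close> by
  further inductions. A contraction \<open>H\<close> of the cone contains all of this at once:
  \<open>D H + H D = 1\<close> is a 2 by 2 matrix identity whose entries include the chain map
  equation for \<open>G\<close> and both homotopy equations. The correction of a first guess
  \<open>H0\<close> works because the extension of a degree -1 map of generators anticommutes with
  the parts of the differential that act on letters only. Hence \<open>D H0 + H0 D\<close> is again
  a bimodule map, determined on generators, and a contraction in length zero makes its lowest
  component the identity. Two kinds of finiteness have to be kept apart. On generators, supports are
  finite and linear algebra over a field supplies the contraction. Elements of the cobimodule are
  infinite sums, and the Neumann series makes sense because each coordinate receives only finitely
  many of its terms.\<close>

definition pairing :: "('a \<Rightarrow> 'k::field) \<Rightarrow> ('a \<Rightarrow> 'k) \<Rightarrow> 'k" where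
  "pairing x k = (\<Sum>a\<in>{a. x a \<noteq> 0}. x a * k a)"

lemma pairing_superset:
  assumes "finite S" "{a. x a \<noteq> 0} \<subseteq> S"
  shows "pairing x k = (\<Sum>a\<in>S. x a * k a)"
  unfolding pairing_def using assms by (intro sum.mono_neutral_left) auto

lemma pairing_zero_left [simp]: "pairing (\<lambda>_. 0) k = 0"
  by (simp add: pairing_def)

lemma pairing_zero_right [simp]: "pairing x (\<lambda>_. 0) = 0"
  by (simp add: pairing_def)

lemma pairing_cong_right:
  "(\<And>a. x a \<noteq> 0 \<Longrightarrow> k a = l a) \<Longrightarrow> pairing x k = pairing x l"
  unfolding pairing_def by (intro sum.cong) auto

lemma pairing_nonzeroE:
  assumes "pairing x k \<noteq> 0"
  obtains a where "x a \<noteq> 0" "k a \<noteq> 0"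
proof -
  obtain a where "a \<in> {a. x a \<noteq> 0}" "x a * k a \<noteq> 0"
    using assms unfolding pairing_def by (rule sum.not_neutral_contains_not_neutral)
  then show thesis using that by auto
qed

text \<open>A sum over an infinite support has the default value 0, so additivity on this side needs
  finiteness; on the right, where the range of summation stays fixed, it is unconditional.\<close>

lemma pairing_add_left:
  assumes "fin_supp x" "fin_supp y"
  shows "pairing (\<lambda>a. x a + y a) k = pairing x k + pairing y k"
proof -
  let ?S = "{a. x a \<noteq> 0} \<union> {a. y a \<noteq> 0}"
  have S: "finite ?S" using assms by (auto simp: fin_supp_def)
  have "pairing (\<lambda>a. x a + y a) k = (\<Sum>a\<in>?S. (x a + y a) * k a)"
    using S by (intro pairing_superset) auto
  also have "\<dots> = (\<Sum>a\<in>?S. x a * k a) + (\<Sum>a\<in>?S. y a * k a)"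
    by (simp add: distrib_right sum.distrib)
  also have "(\<Sum>a\<in>?S. x a * k a) = pairing x k"
    using S by (intro pairing_superset [symmetric]) auto
  also have "(\<Sum>a\<in>?S. y a * k a) = pairing y k"
    using S by (intro pairing_superset [symmetric]) auto
  finally show ?thesis .
qed

lemma pairing_add_right: "pairing x (\<lambda>a. k a + l a) = pairing x k + pairing x l"
  by (simp add: pairing_def distrib_left sum.distrib)

lemma pairing_cmult_left: "pairing (\<lambda>a. s * x a) k = s * pairing x k"
  by (cases "s = 0") (simp_all add: pairing_def sum_distrib_left mult.assoc)

lemma pairing_cmult_right: "pairing x (\<lambda>a. s * k a) = s * pairing x k"
  by (simp add: pairing_def sum_distrib_left mult.left_commute)

lemma pairing_uminus_left: "pairing (\<lambda>a. - x a) k = - pairing x k"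
  using pairing_cmult_left [of "-1" x k] by simp

lemma pairing_uminus_right: "pairing x (\<lambda>a. - k a) = - pairing x k"
  using pairing_cmult_right [of x "-1" k] by simp

lemma pairing_diff_right: "pairing x (\<lambda>a. k a - l a) = pairing x k - pairing x l"
  using pairing_add_right [of x k "\<lambda>a. - l a"] by (simp add: pairing_uminus_right)

lemma pairing_sum_right: "pairing x (\<lambda>a. \<Sum>i\<in>I. k i a) = (\<Sum>i\<in>I. pairing x (k i))"
  unfolding pairing_def by (simp add: sum_distrib_left sum.swap [of _ I])

lemma fin_supp_zero [simp]: "fin_supp (\<lambda>_. 0)"
  by (simp add: fin_supp_def)

lemma fin_supp_add: "fin_supp x \<Longrightarrow> fin_supp y \<Longrightarrow> fin_supp (\<lambda>a. x a + y a :: 'k::field)"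
  unfolding fin_supp_def
  by (rule finite_subset [of _ "{a. x a \<noteq> 0} \<union> {a. y a \<noteq> 0}"]) auto

lemma fin_supp_cmult: "fin_supp x \<Longrightarrow> fin_supp (\<lambda>a. s * x a :: 'k::field)"
  unfolding fin_supp_def by (rule finite_subset [of _ "{a. x a \<noteq> 0}"]) auto

lemma fin_supp_uminus: "fin_supp x \<Longrightarrow> fin_supp (\<lambda>a. - x a :: 'k::field)"
  by (simp add: fin_supp_def)

lemma fin_supp_diff: "fin_supp x \<Longrightarrow> fin_supp y \<Longrightarrow> fin_supp (\<lambda>a. x a - y a :: 'k::field)"
  using fin_supp_add [of x "\<lambda>a. - y a"] by (simp add: fin_supp_uminus)

lemma fin_supp_sum:
  "(\<And>i. i \<in> I \<Longrightarrow> fin_supp (x i)) \<Longrightarrow> fin_supp (\<lambda>a. \<Sum>i\<in>I. x i a :: 'k::field)"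
  by (induction I rule: infinite_finite_induct) (auto intro!: fin_supp_add)

lemma fin_supp_pairing:
  assumes "fin_supp x" "\<And>a. x a \<noteq> 0 \<Longrightarrow> fin_supp (\<phi> a)"
  shows "fin_supp (\<lambda>b. pairing x (\<lambda>a. \<phi> a b))"
  unfolding pairing_def by (intro fin_supp_sum fin_supp_cmult) (auto simp: assms)

lemma pairing_sum_left:
  assumes "\<And>i. i \<in> I \<Longrightarrow> fin_supp (x i)"
  shows "pairing (\<lambda>a. \<Sum>i\<in>I. x i a) k = (\<Sum>i\<in>I. pairing (x i) k)"
  using assms
  by (induction I rule: infinite_finite_induct)
    (simp_all add: pairing_add_left fin_supp_sum)

text \<open>Associativity of the matrix product; only the rows of \<open>\<phi>\<close> that
  \<open>x\<close> meets have to be finite.\<close>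

lemma pairing_assoc:
  assumes "fin_supp x" "\<And>a. x a \<noteq> 0 \<Longrightarrow> fin_supp (\<phi> a)"
  shows "pairing (\<lambda>b. pairing x (\<lambda>a. \<phi> a b)) k = pairing x (\<lambda>a. pairing (\<phi> a) k)"
  using assms unfolding pairing_def [of x]
  by (subst pairing_sum_left) (auto intro: fin_supp_cmult simp: pairing_cmult_left)

text \<open>Maps acting on different tensor factors commute. The interchange of sums asks for joint
  finiteness of the support of \<open>X\<close>, which is more than finite rows and columns.\<close>

lemma pairing_swap:
  assumes "finite {(a, b). X a b \<noteq> 0}"
  shows "pairing (\<lambda>a. pairing (\<lambda>b. X a b) l) k = pairing (\<lambda>b. pairing (\<lambda>a. X a b) k) l"
proof -
  let ?P = "{(a, b). X a b \<noteq> 0}"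
  let ?A = "fst ` ?P" and ?B = "snd ` ?P"
  have A: "finite ?A" and B: "finite ?B" using assms by auto
  have 1: "pairing (\<lambda>b. X a b) l = (\<Sum>b\<in>?B. X a b * l b)" for a
    using B by (intro pairing_superset) (auto simp: image_iff)
  have 2: "pairing (\<lambda>a. X a b) k = (\<Sum>a\<in>?A. X a b * k a)" for b
    using A by (intro pairing_superset) (auto simp: image_iff)
  have "pairing (\<lambda>a. pairing (\<lambda>b. X a b) l) k = (\<Sum>a\<in>?A. pairing (\<lambda>b. X a b) l * k a)"
    using A by (intro pairing_superset) (auto simp: image_iff elim!: pairing_nonzeroE)
  also have "\<dots> = (\<Sum>b\<in>?B. pairing (\<lambda>a. X a b) k * l b)"
    unfolding 1 2 sum_distrib_right by (subst sum.swap) (simp add: mult_ac)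
  also have "\<dots> = pairing (\<lambda>b. pairing (\<lambda>a. X a b) k) l"
    using B by (intro pairing_superset [symmetric]) (auto simp: image_iff elim!: pairing_nonzeroE)
  finally show ?thesis .
qed

lemma fin_supp_pairing_left:
  assumes "finite {(a, b). X a b \<noteq> 0}"
  shows "fin_supp (\<lambda>b. pairing (\<lambda>a. X a b) k)"
  unfolding fin_supp_def
proof (rule finite_subset)
  show "{b. pairing (\<lambda>a. X a b) k \<noteq> 0} \<subseteq> snd ` {(a, b). X a b \<noteq> 0}"
    by (auto simp: image_iff elim!: pairing_nonzeroE)
  show "finite (snd ` {(a, b). X a b \<noteq> 0})" using assms by simp
qed

lemma pairing_delta: "pairing (\<lambda>a. if a = b then 1 else 0) k = k b"
proof -
  have "pairing (\<lambda>a. if a = b then 1 else 0) k = (\<Sum>a\<in>{b}. (if a = b then 1 else 0) * k a)"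
    by (intro pairing_superset) auto
  then show ?thesis by simp
qed

lemma pairing_delta_right:
  assumes "fin_supp x"
  shows "pairing x (\<lambda>a. if a = b then 1 else 0) = x b"
proof -
  have "pairing x (\<lambda>a. if a = b then 1 else 0)
      = (\<Sum>a\<in>insert b {a. x a \<noteq> 0}. x a * (if a = b then 1 else 0))"
    using assms by (intro pairing_superset) (auto simp: fin_supp_def)
  also have "\<dots> = (\<Sum>a\<in>insert b {a. x a \<noteq> 0}. if a = b then x a else 0)"
    by (intro sum.cong) auto
  also have "\<dots> = x b" using assms by (simp add: fin_supp_def)
  finally show ?thesis .
qed

section \<open>Homogeneous elements and Koszul signs\<close>

lemma homog_pairing:
  assumes "homog deg n x" "\<And>a. homog deg' (deg a + k) (\<phi> a)"
  shows "homog deg' (n + k) (\<lambda>b. pairing x (\<lambda>a. \<phi> a b))"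
  using assms unfolding homog_def by (metis pairing_nonzeroE)

lemma homog_zero [simp]: "homog deg n (\<lambda>_. 0)"
  by (simp add: homog_def)

lemma homog_add:
  "homog deg n x \<Longrightarrow> homog deg n y \<Longrightarrow> homog deg n (\<lambda>a. x a + y a :: 'k::field)"
  unfolding homog_def by (metis add_0)

lemma homog_uminus: "homog deg n x \<Longrightarrow> homog deg n (\<lambda>a. - x a :: 'k::field)"
  by (simp add: homog_def)

lemma homog_diff:
  "homog deg n x \<Longrightarrow> homog deg n y \<Longrightarrow> homog deg n (\<lambda>a. x a - y a :: 'k::field)"
  unfolding homog_def by (metis diff_self)

lemma ksign_mult_self [simp]: "ksign a * ksign a = 1"
  by (simp add: ksign_def)

lemma ksign_add: "ksign (a + b) = ksign a * ksign b"
  by (auto simp: ksign_def)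

lemma ksign_add_1 [simp]: "ksign (a + 1) = - ksign a" "ksign (1 + a) = - ksign a"
  by (auto simp: ksign_def)

lemma ksign_diff_1 [simp]: "ksign (a - 1) = - ksign a"
  by (auto simp: ksign_def)

lemma ksign_0 [simp]: "ksign 0 = 1"
  by (simp add: ksign_def)

lemma ksign_nonzero [simp]: "ksign a \<noteq> 0"
  by (simp add: ksign_def)

lemma wdeg_append [simp]: "wdeg degc (u @ v) = wdeg degc u + wdeg degc v"
  by (simp add: wdeg_def)

lemma wdeg_Nil [simp]: "wdeg degc [] = 0"
  by (simp add: wdeg_def)

lemma wdeg_Cons [simp]: "wdeg degc (c # v) = degc c + wdeg degc v"
  by (simp add: wdeg_def)

section \<open>Bimodule maps and their composition\<close>

definition splits :: "'c list \<Rightarrow> ('c list \<times> 'c list) set" where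
  "splits w = {(u, p). u @ p = w}"

definition splits3 :: "'c list \<Rightarrow> ('c list \<times> 'c list \<times> 'c list) set" where
  "splits3 w = {(u, v, z). u @ v @ z = w}"

lemma finite_splits [simp]: "finite (splits w)"
proof -
  have "splits w \<subseteq> (\<lambda>i. (take i w, drop i w)) ` {..length w}"
  proof
    fix t assume "t \<in> splits w"
    then show "t \<in> (\<lambda>i. (take i w, drop i w)) ` {..length w}"
      by (intro image_eqI [of _ _ "length (fst t)"]) (auto simp: splits_def)
  qed
  then show ?thesis by (rule finite_subset) simp
qed

lemma finite_splits3 [simp]: "finite (splits3 w)"
proof -
  have "splits3 w \<subseteq> (\<Union>(u, p)\<in>splits w. (\<lambda>(v, z). (u, v, z)) ` splits p)"
    by (auto simp: splits_def splits3_def)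
  then show ?thesis by (rule finite_subset) auto
qed

lemma splits_Nil [simp]: "splits [] = {([], [])}"
  by (auto simp: splits_def)

lemma splits_trivial [simp]: "(w, []) \<in> splits w" "([], w) \<in> splits w"
  by (auto simp: splits_def)

text \<open>Coassociativity of deconcatenation: both sides run over the cuts of \<open>w\<close>
  into three words.\<close>

lemma sum_splits_assoc:
  "(\<Sum>(a, r)\<in>splits w. \<Sum>(u, p)\<in>splits a. f u p r)
    = (\<Sum>(u, s)\<in>splits w. \<Sum>(p, r)\<in>splits s. f u p r)"
proof -
  have "(\<Sum>(a, r)\<in>splits w. \<Sum>(u, p)\<in>splits a. f u p r)
      = (\<Sum>x\<in>(SIGMA (a, r):splits w. splits a). case x of ((a, r), (u, p)) \<Rightarrow> f u p r)"
    by (subst sum.Sigma [symmetric]) (auto intro!: sum.cong)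
  also have "\<dots> = (\<Sum>x\<in>(SIGMA (u, s):splits w. splits s). case x of ((u, s), (p, r)) \<Rightarrow> f u p r)"
    by (rule sum.reindex_bij_witness
        [of _ "\<lambda>((u, s), (p, r)). ((u @ p, r), (u, p))" "\<lambda>((a, r), (u, p)). ((u, p @ r), (p, r))"])
      (auto simp: splits_def)
  also have "\<dots> = (\<Sum>(u, s)\<in>splits w. \<Sum>(p, r)\<in>splits s. f u p r)"
    by (subst sum.Sigma [symmetric]) (auto intro!: sum.cong)
  finally show ?thesis .
qed

text \<open>Only the parity of \<open>e\<close>, the degree of the map, matters.\<close>
definition bimod_ext :: "('c \<Rightarrow> int) \<Rightarrow> int \<Rightarrow> ('m \<Rightarrow> ('c list \<times> 'n \<times> 'c list) \<Rightarrow> 'k::field)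
    \<Rightarrow> (('c list \<times> 'm \<times> 'c list) \<Rightarrow> 'k) \<Rightarrow> (('c list \<times> 'n \<times> 'c list) \<Rightarrow> 'k)" where
  "bimod_ext degc e \<phi> x = (\<lambda>(u', n', v').
      \<Sum>(u, p)\<in>splits u'. \<Sum>(q, z)\<in>splits v'.
        ksign (e * wdeg degc u) * pairing (\<lambda>m. x (u, m, z)) (\<lambda>m. \<phi> m (p, n', q)))"

lemma bimod_ext_apply:
  "bimod_ext degc e \<phi> x (u', n', v') =
      (\<Sum>(u, p)\<in>splits u'. \<Sum>(q, z)\<in>splits v'.
        ksign (e * wdeg degc u) * pairing (\<lambda>m. x (u, m, z)) (\<lambda>m. \<phi> m (p, n', q)))"
  by (simp add: bimod_ext_def)

text \<open>A map of degree 0 produces no sign, so \<open>degc\<close> is arbitrary here and has to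
  be supplied when rewriting.\<close>

lemma Fext_eq: "Fext f = bimod_ext degc 0 f"
  by (intro ext) (simp add: Fext_def bimod_ext_def splits_def pairing_def)

lemma comp00_eq: "comp00 f x = (\<lambda>n. pairing x (\<lambda>m. f m ([], n, [])))"
  by (auto simp: comp00_def pairing_def)

section \<open>Admissible elements\<close>

lemma adm_BM_iff:
  "adm_BM x \<longleftrightarrow> (\<forall>i j. finite {t. length (fst t) = i \<and> length (snd (snd t)) = j \<and> x t \<noteq> 0})"
proof -
  have "{(u, m, v). length u = i \<and> length v = j \<and> x (u, m, v) \<noteq> 0}
     = {t. length (fst t) = i \<and> length (snd (snd t)) = j \<and> x t \<noteq> 0}" for i j
    by auto
  then show ?thesis by (simp add: adm_BM_def)
qed

lemma adm_BM_subsetI: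
  assumes "\<And>i j. \<exists>A. finite A \<and> (\<forall>u m v. length u = i \<longrightarrow> length v = j \<longrightarrow> x (u, m, v) \<noteq> 0 \<longrightarrow> (u, m, v) \<in> A)"
  shows "adm_BM x"
  unfolding adm_BM_iff
proof (intro allI)
  fix i j
  obtain A where A: "finite A"
      "\<forall>u m v. length u = i \<longrightarrow> length v = j \<longrightarrow> x (u, m, v) \<noteq> 0 \<longrightarrow> (u, m, v) \<in> A"
    using assms [of i j] by (elim exE conjE)
  have "{t. length (fst t) = i \<and> length (snd (snd t)) = j \<and> x t \<noteq> 0} \<subseteq> A"
    using A(2) by force
  then show "finite {t. length (fst t) = i \<and> length (snd (snd t)) = j \<and> x t \<noteq> 0}"
    using A(1) by (rule finite_subset)
qed

lemma adm_BM_finite: "adm_BM x \<Longrightarrow> finite {(u, m, v). length u = i \<and> length v = j \<and> x (u, m, v) \<noteq> 0}"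
  by (simp add: adm_BM_def)

lemma adm_BM_finite_le:
  assumes "adm_BM x"
  shows "finite {(u, m, v). length u \<le> i \<and> length v \<le> j \<and> x (u, m, v) \<noteq> 0}"
proof (rule finite_subset)
  let ?A = "\<Union>k\<in>{..i}. \<Union>l\<in>{..j}. {(u, m, v). length u = k \<and> length v = l \<and> x (u, m, v) \<noteq> 0}"
  show "{(u, m, v). length u \<le> i \<and> length v \<le> j \<and> x (u, m, v) \<noteq> 0} \<subseteq> ?A"
    by clarsimp
  show "finite ?A"
    using assms by (intro finite_UN_I adm_BM_finite finite_atMost)
qed

lemma adm_BM_zero [simp]: "adm_BM (\<lambda>_. 0)"
  by (simp add: adm_BM_iff)

lemma adm_BM_add:
  assumes "adm_BM x" "adm_BM y"
  shows "adm_BM (\<lambda>t. x t + y t :: 'k::field)"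
proof (rule adm_BM_subsetI, intro exI conjI allI impI)
  fix i j
  show "finite ({(u, m, v). length u = i \<and> length v = j \<and> x (u, m, v) \<noteq> 0}
    \<union> {(u, m, v). length u = i \<and> length v = j \<and> y (u, m, v) \<noteq> 0})"
    using assms by (intro finite_UnI adm_BM_finite)
qed auto

lemma adm_BM_uminus: "adm_BM x \<Longrightarrow> adm_BM (\<lambda>t. - x t :: 'k::field)"
  by (simp add: adm_BM_def)

lemma adm_BM_diff: "adm_BM x \<Longrightarrow> adm_BM y \<Longrightarrow> adm_BM (\<lambda>t. x t - y t :: 'k::field)"
  using adm_BM_add [of x "\<lambda>t. - y t"] by (simp add: adm_BM_uminus)

lemma fin_supp_slice:
  assumes "adm_BM x"
  shows "fin_supp (\<lambda>m. x (u, m, v))"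
  unfolding fin_supp_def
proof (rule finite_subset)
  let ?A = "{(u', m, v'). length u' = length u \<and> length v' = length v \<and> x (u', m, v') \<noteq> 0}"
  show "{m. x (u, m, v) \<noteq> 0} \<subseteq> (\<lambda>(u, m, v). m) ` ?A"
    by (auto intro!: rev_image_eqI [of "(u, _, v)"])
  show "finite ((\<lambda>(u, m, v). m) ` ?A)"
    using assms by (intro finite_imageI adm_BM_finite)
qed

text \<open>Letter and generator are bounded jointly, as \<open>pairing_swap\<close> requires,
  because all triples involved share their word lengths.\<close>

lemma finite_slice_left:
  assumes "adm_BM x"
  shows "finite {(c, m). x (u @ [c] @ z, m, v) \<noteq> 0}"
proof (rule finite_subset)
  let ?A = "{(u', m, v'). length u' = length u + 1 + length z \<and> length v' = length v \<and> x (u', m, v') \<noteq> 0}"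
  show "{(c, m). x (u @ [c] @ z, m, v) \<noteq> 0} \<subseteq> (\<lambda>(u', m, v'). (u' ! length u, m)) ` ?A"
    by (auto intro!: rev_image_eqI [of "(u @ _ # z, _, v)"])
  show "finite ((\<lambda>(u', m, v'). (u' ! length u, m)) ` ?A)"
    using assms by (intro finite_imageI adm_BM_finite)
qed

lemma finite_slice_right:
  assumes "adm_BM x"
  shows "finite {(c, m). x (v, m, u @ [c] @ z) \<noteq> 0}"
proof (rule finite_subset)
  let ?A = "{(v', m, u'). length v' = length v \<and> length u' = length u + 1 + length z \<and> x (v', m, u') \<noteq> 0}"
  show "{(c, m). x (v, m, u @ [c] @ z) \<noteq> 0} \<subseteq> (\<lambda>(v', m, u'). (u' ! length u, m)) ` ?A"
    by (auto intro!: rev_image_eqI [of "(v, _, u @ _ # z)"])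
  show "finite ((\<lambda>(v', m, u'). (u' ! length u, m)) ` ?A)"
    using assms by (intro finite_imageI adm_BM_finite)
qed

lemma fin_supp_slice_left:
  assumes "adm_BM x"
  shows "fin_supp (\<lambda>c. x (u @ [c] @ z, m, v))"
  unfolding fin_supp_def
  by (rule finite_subset [OF _ finite_imageI [OF finite_slice_left [OF assms, of u z v], of fst]])
    (auto intro!: rev_image_eqI [of "(_, m)"])

lemma fin_supp_slice_right:
  assumes "adm_BM x"
  shows "fin_supp (\<lambda>c. x (v, m, u @ [c] @ z))"
  unfolding fin_supp_def
  by (rule finite_subset [OF _ finite_imageI [OF finite_slice_right [OF assms, of v u z], of fst]])
    (auto intro!: rev_image_eqI [of "(_, m)"])

lemma bimod_ext_nonzeroE:
  assumes "bimod_ext degc e \<phi> x (u', n', v') \<noteq> 0"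
  obtains u p q z m where "u' = u @ p" "v' = q @ z" "x (u, m, z) \<noteq> 0" "\<phi> m (p, n', q) \<noteq> 0"
proof -
  obtain t where t: "t \<in> splits u'"
    and nz: "(case t of (u, p) \<Rightarrow> \<Sum>(q, z)\<in>splits v'. ksign (e * wdeg degc u) *
      pairing (\<lambda>m. x (u, m, z)) (\<lambda>m. \<phi> m (p, n', q))) \<noteq> 0"
    using assms unfolding bimod_ext_apply by (rule sum.not_neutral_contains_not_neutral)
  obtain u p where up: "t = (u, p)" by (cases t)
  obtain s where s: "s \<in> splits v'"
    and nz': "(case s of (q, z) \<Rightarrow> ksign (e * wdeg degc u) *
      pairing (\<lambda>m. x (u, m, z)) (\<lambda>m. \<phi> m (p, n', q))) \<noteq> 0"
    using nz unfolding up prod.case by (rule sum.not_neutral_contains_not_neutral)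
  obtain q z where qz: "s = (q, z)" by (cases s)
  have "pairing (\<lambda>m. x (u, m, z)) (\<lambda>m. \<phi> m (p, n', q)) \<noteq> 0"
    using nz' by (auto simp: qz)
  then obtain m where "x (u, m, z) \<noteq> 0" "\<phi> m (p, n', q) \<noteq> 0"
    by (auto elim!: pairing_nonzeroE)
  then show thesis using that t s by (auto simp: splits_def up qz)
qed

text \<open>Words are only extended: an entry of \<open>x\<close> contributing to lengths
  \<open>(i, j)\<close> has lengths at most \<open>(i, j)\<close>, and so has the entry of
  \<open>\<phi>\<close> glued to it. Admissibility makes both ranges finite.\<close>

lemma adm_BM_bimod_ext:
  assumes x: "adm_BM x" and \<phi>: "\<And>m. adm_BM (\<phi> m)"
  shows "adm_BM (bimod_ext degc e \<phi> x)"
proof (rule adm_BM_subsetI, intro exI conjI allI impI)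
  fix i j
  let ?X = "{(u, m, z). length u \<le> i \<and> length z \<le> j \<and> x (u, m, z) \<noteq> 0}"
  let ?Y = "\<lambda>m. {(p, n, q). length p \<le> i \<and> length q \<le> j \<and> \<phi> m (p, n, q) \<noteq> 0}"
  let ?A = "\<Union>(u, m, z)\<in>?X. (\<lambda>(p, n, q). (u @ p, n, q @ z)) ` ?Y m"
  show "finite ?A"
    using adm_BM_finite_le [OF x] adm_BM_finite_le [OF \<phi>] by auto
  fix u' n' v'
  assume len: "length u' = i" "length v' = j" and nz: "bimod_ext degc e \<phi> x (u', n', v') \<noteq> 0"
  obtain u p q z m where *: "u' = u @ p" "v' = q @ z" "x (u, m, z) \<noteq> 0" "\<phi> m (p, n', q) \<noteq> 0"
    using nz by (rule bimod_ext_nonzeroE)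
  have "(u, m, z) \<in> ?X" using * len by auto
  moreover have "(u', n', v') \<in> (\<lambda>(p, n, q). (u @ p, n, q @ z)) ` ?Y m"
    by (rule image_eqI [of _ _ "(p, n', q)"]) (use * len in auto)
  ultimately show "(u', n', v') \<in> ?A" by blast
qed

lemma homog_bimod_ext:
  assumes "homog (tdeg degc degm) k x" "\<And>m. homog (tdeg degc degn) (degm m + l) (\<phi> m)"
  shows "homog (tdeg degc degn) (k + l) (bimod_ext degc e \<phi> x)"
  unfolding homog_def
proof (intro allI impI)
  fix t assume nz: "bimod_ext degc e \<phi> x t \<noteq> 0"
  obtain u' n' v' where t: "t = (u', n', v')" by (cases t)
  obtain u p q z m where *: "u' = u @ p" "v' = q @ z" "x (u, m, z) \<noteq> 0" "\<phi> m (p, n', q) \<noteq> 0"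
    using nz unfolding t by (rule bimod_ext_nonzeroE)
  have "tdeg degc degm (u, m, z) = k" "tdeg degc degn (p, n', q) = degm m + l"
    using assms * by (auto simp: homog_def)
  then show "tdeg degc degn t = k + l" using * t by (simp add: tdeg_def)
qed

lemma bimod_ext_zero [simp]: "bimod_ext degc e \<phi> (\<lambda>_. 0) = (\<lambda>_. 0)"
  by (intro ext) (auto simp: bimod_ext_def)

lemma bimod_ext_add:
  assumes "adm_BM x" "adm_BM y"
  shows "bimod_ext degc e \<phi> (\<lambda>t. x t + y t) = (\<lambda>t. bimod_ext degc e \<phi> x t + bimod_ext degc e \<phi> y t)"
  by (intro ext) (auto simp: bimod_ext_def pairing_add_left fin_supp_slice assms distrib_left
      sum.distrib case_prod_beta)

lemma bimod_ext_uminus: "bimod_ext degc e \<phi> (\<lambda>t. - x t) = (\<lambda>t. - bimod_ext degc e \<phi> x t)"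
  by (intro ext) (auto simp: bimod_ext_def pairing_uminus_left sum_negf case_prod_beta)

lemma bimod_ext_diff:
  assumes "adm_BM x" "adm_BM y"
  shows "bimod_ext degc e \<phi> (\<lambda>t. x t - y t) = (\<lambda>t. bimod_ext degc e \<phi> x t - bimod_ext degc e \<phi> y t)"
  using bimod_ext_add [OF assms(1) adm_BM_uminus [OF assms(2)], of degc e \<phi>]
  by (simp add: bimod_ext_uminus)

lemma bimod_ext_add_right:
  "bimod_ext degc e (\<lambda>m t. \<phi> m t + \<psi> m t) x = (\<lambda>t. bimod_ext degc e \<phi> x t + bimod_ext degc e \<psi> x t)"
  by (intro ext) (auto simp: bimod_ext_def pairing_add_right distrib_left
      sum.distrib case_prod_beta)

lemma bimod_ext_diff_right:
  "bimod_ext degc e (\<lambda>m t. \<phi> m t - \<psi> m t) x = (\<lambda>t. bimod_ext degc e \<phi> x t - bimod_ext degc e \<psi> x t)"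
  by (intro ext) (auto simp: bimod_ext_def pairing_diff_right right_diff_distrib
      sum_subtractf case_prod_beta)

lemma bimod_ext_even:
  assumes "even e" shows "bimod_ext degc e \<phi> = bimod_ext degc 0 \<phi>"
  using assms by (intro ext) (simp add: bimod_ext_def ksign_def)

text \<open>Coassociativity, applied to the left and to the right word, matches the summands. The
  signs agree because \<open>e' (|u| + |p|) + e |u| = (e + e') |u| + e' |p|\<close>.\<close>

lemma bimod_ext_comp:
  assumes x: "adm_BM x" and \<phi>: "\<And>m. adm_BM (\<phi> m)"
  shows "bimod_ext degc e' \<psi> (bimod_ext degc e \<phi> x)
       = bimod_ext degc (e + e') (\<lambda>m. bimod_ext degc e' \<psi> (\<phi> m)) x"
proof (intro ext, clarify)
  fix u' n' v'
  \<comment> \<open>The left word is cut as \<open>u @ p @ r\<close> and the right one as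
    \<open>s @ q @ z\<close>: the outer pair comes from \<open>x\<close>, the middle pair from
    \<open>\<phi>\<close>, the inner pair from \<open>\<psi>\<close>.\<close>
  define T where "T u p r s q z = ksign (e' * (wdeg degc u + wdeg degc p)) * (ksign (e * wdeg degc u) *
      pairing (\<lambda>m. x (u, m, z)) (\<lambda>m. pairing (\<lambda>n. \<phi> m (p, n, q)) (\<lambda>n. \<psi> n (r, n', s))))"
    for u p r s q z
  have pa: "pairing (\<lambda>n. pairing (\<lambda>m. x (u, m, z)) (\<lambda>m. \<phi> m (p, n, q))) k
      = pairing (\<lambda>m. x (u, m, z)) (\<lambda>m. pairing (\<lambda>n. \<phi> m (p, n, q)) k)" for u p q z k
    by (rule pairing_assoc) (auto intro: fin_supp_slice x \<phi>)
  have fs: "fin_supp (\<lambda>n. ksign (e * wdeg degc u) * pairing (\<lambda>m. x (u, m, z)) (\<lambda>m. \<phi> m (p, n, q)))"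
    for u p q z
    by (intro fin_supp_cmult fin_supp_pairing fin_supp_slice x \<phi>)
  have "bimod_ext degc e' \<psi> (bimod_ext degc e \<phi> x) (u', n', v')
      = (\<Sum>(a, r)\<in>splits u'. \<Sum>(s, b)\<in>splits v'. \<Sum>(u, p)\<in>splits a. \<Sum>(q, z)\<in>splits b. T u p r s q z)"
    unfolding bimod_ext_apply
  proof (intro sum.cong refl, clarify, intro sum.cong refl, clarify)
    fix a r s b
    have "pairing (\<lambda>n. \<Sum>(u, p)\<in>splits a. \<Sum>(q, z)\<in>splits b.
           ksign (e * wdeg degc u) * pairing (\<lambda>m. x (u, m, z)) (\<lambda>m. \<phi> m (p, n, q))) (\<lambda>n. \<psi> n (r, n', s))
       = (\<Sum>(u, p)\<in>splits a. \<Sum>(q, z)\<in>splits b. ksign (e * wdeg degc u) *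
            pairing (\<lambda>m. x (u, m, z)) (\<lambda>m. pairing (\<lambda>n. \<phi> m (p, n, q)) (\<lambda>n. \<psi> n (r, n', s))))"
      using fs
      by (simp add: case_prod_beta pairing_sum_left fin_supp_sum pairing_cmult_left pa)
    then show "ksign (e' * wdeg degc a) * pairing (\<lambda>n. \<Sum>(u, p)\<in>splits a. \<Sum>(q, z)\<in>splits b.
           ksign (e * wdeg degc u) * pairing (\<lambda>m. x (u, m, z)) (\<lambda>m. \<phi> m (p, n, q))) (\<lambda>n. \<psi> n (r, n', s))
       = (\<Sum>(u, p)\<in>splits a. \<Sum>(q, z)\<in>splits b. T u p r s q z)"
      by (auto simp: sum_distrib_left T_def splits_def intro!: sum.cong)
  qed
  also have "\<dots> = (\<Sum>(a, r)\<in>splits u'. \<Sum>(u, p)\<in>splits a. \<Sum>(s, b)\<in>splits v'. \<Sum>(q, z)\<in>splits b. T u p r s q z)"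
    by (intro sum.cong refl, clarify) (simp add: case_prod_beta sum.swap [of _ "splits v'"])
  also have "\<dots> = (\<Sum>(u, t)\<in>splits u'. \<Sum>(p, r)\<in>splits t. \<Sum>(s, b)\<in>splits v'. \<Sum>(q, z)\<in>splits b. T u p r s q z)"
    by (rule sum_splits_assoc)
  also have "\<dots> = (\<Sum>(u, t)\<in>splits u'. \<Sum>(p, r)\<in>splits t. \<Sum>(c, z)\<in>splits v'. \<Sum>(s, q)\<in>splits c. T u p r s q z)"
    by (simp add: sum_splits_assoc)
  also have "\<dots> = (\<Sum>(u, t)\<in>splits u'. \<Sum>(c, z)\<in>splits v'. \<Sum>(p, r)\<in>splits t. \<Sum>(s, q)\<in>splits c. T u p r s q z)"
    by (intro sum.cong refl, clarify) (simp add: case_prod_beta sum.swap [of _ "splits v'"])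
  also have "\<dots> = bimod_ext degc (e + e') (\<lambda>m. bimod_ext degc e' \<psi> (\<phi> m)) x (u', n', v')"
    unfolding bimod_ext_apply case_prod_beta pairing_sum_right pairing_cmult_right sum_distrib_left
    by (intro sum.cong refl) (simp add: T_def distrib_left distrib_right ksign_add mult_ac)
  finally show "bimod_ext degc e' \<psi> (bimod_ext degc e \<phi> x) (u', n', v')
       = bimod_ext degc (e + e') (\<lambda>m. bimod_ext degc e' \<psi> (\<phi> m)) x (u', n', v')" .
qed

section \<open>Maps that act on the generator alone\<close>

definition gen_diag :: "('m \<Rightarrow> 'n \<Rightarrow> 'k::field) \<Rightarrow> 'm \<Rightarrow> ('c list \<times> 'n \<times> 'c list) \<Rightarrow> 'k" where
  "gen_diag h m = (\<lambda>(p, n, q). if p = [] \<and> q = [] then h m n else 0)"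

abbreviation gen_id :: "'m \<Rightarrow> ('c list \<times> 'm \<times> 'c list) \<Rightarrow> 'k::field" where
  "gen_id \<equiv> gen_diag (\<lambda>m n. if n = m then 1 else 0)"

lemma gen_diag_apply: "gen_diag h m (p, n, q) = (if p = [] \<and> q = [] then h m n else 0)"
  by (simp add: gen_diag_def)

lemma adm_BM_gen_diag:
  assumes "fin_supp (h m)"
  shows "adm_BM (gen_diag h m)"
proof (rule adm_BM_subsetI, intro exI conjI allI impI)
  show "finite ((\<lambda>n. ([], n, [])) ` {n. h m n \<noteq> 0})"
    using assms by (simp add: fin_supp_def)
qed (auto simp: gen_diag_apply split: if_splits)

lemma adm_BM_gen_id: "adm_BM (gen_id m)"
  by (rule adm_BM_gen_diag) (simp add: fin_supp_def)

lemma homog_gen_diag: "homog degn k (h m) \<Longrightarrow> homog (tdeg degc degn) k (gen_diag h m)"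
  by (auto simp: homog_def gen_diag_apply tdeg_def split: if_splits)

text \<open>Only the cuts that split nothing off contribute, which leaves
  \<open>1 \<otimes> h \<otimes> 1\<close> with its Koszul sign.\<close>

lemma bimod_ext_gen_diag:
  "bimod_ext degc e (gen_diag h) x (u, n, v)
     = ksign (e * wdeg degc u) * pairing (\<lambda>m. x (u, m, v)) (\<lambda>m. h m n)" (is "_ = ?K")
proof -
  have 0: "ksign (e * wdeg degc (fst s)) * pairing (\<lambda>m. x (fst s, m, snd t)) (\<lambda>m. gen_diag h m (snd s, n, fst t))
      = (if s = (u, []) then if t = ([], v) then ?K else 0 else 0)"
    if "s \<in> splits u" "t \<in> splits v" for s t
    using that by (cases "snd s = [] \<and> fst t = []"; cases s; cases t) (auto simp: splits_def gen_diag_apply)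
  have "bimod_ext degc e (gen_diag h) x (u, n, v)
      = (\<Sum>s\<in>splits u. \<Sum>t\<in>splits v. if s = (u, []) then if t = ([], v) then ?K else 0 else 0)"
    unfolding bimod_ext_apply case_prod_beta using 0 by (intro sum.cong refl) auto
  also have "\<dots> = (\<Sum>s\<in>splits u. if s = (u, []) then ?K else 0)"
    by (intro sum.cong refl) simp
  also have "\<dots> = ?K" by simp
  finally show ?thesis .
qed

lemma bimod_ext_gen_id:
  assumes "adm_BM x"
  shows "bimod_ext degc e gen_id x (u, n, v) = ksign (e * wdeg degc u) * x (u, n, v)"
  using pairing_delta_right [OF fin_supp_slice [OF assms, of u v], of n]
  by (simp add: bimod_ext_gen_diag eq_commute [of n])

lemma bimod_ext_00: "bimod_ext degc e \<phi> x ([], n, []) = comp00 \<phi> (\<lambda>m. x ([], m, [])) n"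
  by (simp add: bimod_ext_apply comp00_eq)

section \<open>Word length and the Neumann series\<close>

definition tlen :: "'c list \<times> 'm \<times> 'c list \<Rightarrow> nat" where
  "tlen t = length (fst t) + length (snd (snd t))"

text \<open>Without a (0,0)-component \<open>\<nu>\<close> adds at least one letter, so a coordinate
  of the image sees only coordinates of smaller total length. This takes the place of a notion of
  convergence.\<close>

lemma bimod_ext_local:
  assumes \<nu>: "\<And>m n. \<nu> m ([], n, []) = 0"
    and eq: "\<And>s. tlen s < tlen t \<Longrightarrow> x s = y s"
  shows "bimod_ext degc e \<nu> x t = bimod_ext degc e \<nu> y t"
proof -
  obtain u' n' v' where t: "t = (u', n', v')" by (cases t)
  have "pairing (\<lambda>m. x (u, m, z)) (\<lambda>m. \<nu> m (p, n', q)) = pairing (\<lambda>m. y (u, m, z)) (\<lambda>m. \<nu> m (p, n', q))"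
    if "u' = u @ p" "v' = q @ z" for u p q z
  proof (cases "p = [] \<and> q = []")
    case True
    then show ?thesis by (simp add: \<nu>)
  next
    case False
    then have "(\<lambda>m. x (u, m, z)) = (\<lambda>m. y (u, m, z))"
      using that by (intro ext eq) (auto simp: t tlen_def)
    then show ?thesis by simp
  qed
  then show ?thesis
    unfolding t bimod_ext_apply by (intro sum.cong refl) (auto simp: splits_def intro!: sum.cong)
qed

text \<open>Injectivity of \<open>1 - N\<close> for the extension \<open>N\<close> of
  \<open>\<nu>\<close>: identities about the Neumann series can then be derived from its fixed-point
  equation.\<close>

lemma bimod_map_fixpoint_zero:
  assumes \<nu>: "\<And>m n. \<nu> m ([], n, []) = 0" and eq: "bimod_ext degc e \<nu> x = x"
  shows "x = (\<lambda>_. 0)"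
proof
  fix t show "x t = 0"
  proof (induction "tlen t" arbitrary: t rule: less_induct)
    case less
    have "x t = bimod_ext degc e \<nu> x t" by (simp add: eq)
    also have "\<dots> = bimod_ext degc e \<nu> (\<lambda>_. 0) t"
      by (rule bimod_ext_local) (auto simp: \<nu> less)
    finally show ?case by simp
  qed
qed

text \<open>A right inverse of \<open>1 - N\<close> on generators, characterised by a fixed-point
  equation in place of an infinite sum.\<close>

lemma neumann_series:
  assumes adm: "\<And>m. adm_BM (\<nu> m)" and \<nu>: "\<And>m n. \<nu> m ([], n, []) = (0 :: 'k::field)"
    and hom: "\<And>m. homog (tdeg degc degm) (degm m) (\<nu> m)"
  obtains \<sigma> where "\<And>m. adm_BM (\<sigma> m)" "\<And>m. homog (tdeg degc degm) (degm m) (\<sigma> m)"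
    "\<And>m. \<sigma> m = (\<lambda>t. gen_id m t + bimod_ext degc 0 \<nu> (\<sigma> m) t)"
proof -
  \<comment> \<open>\<open>s k\<close> is the partial sum \<open>1 + N + ... + N^k\<close> on
    generators, in Horner form.\<close>
  define s where "s k m = ((\<lambda>x t. gen_id m t + bimod_ext degc 0 \<nu> x t) ^^ k) (gen_id m)" for k m
  have s_0: "s 0 m = gen_id m" for m by (simp add: s_def)
  have s_Suc: "s (Suc k) m = (\<lambda>t. gen_id m t + bimod_ext degc 0 \<nu> (s k m) t)" for k m
    by (simp add: s_def)
  \<comment> \<open>By locality each further step settles one more total length, beginning with
    length 0, where \<open>\<nu>\<close> contributes nothing.\<close>
  have step: "s (Suc k) m t = s k m t" if "tlen t \<le> k" for k m t
    using that
  proof (induction k arbitrary: t)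
    case 0
    then obtain n where "t = ([], n, [])" by (cases t) (auto simp: tlen_def)
    then show ?case by (simp add: s_Suc s_0 bimod_ext_00 comp00_eq \<nu>)
  next
    case (Suc k)
    have "bimod_ext degc 0 \<nu> (s (Suc k) m) t = bimod_ext degc 0 \<nu> (s k m) t"
      using Suc by (intro bimod_ext_local) (auto simp: \<nu>)
    then show ?case by (simp only: s_Suc)
  qed
  have stable: "s k m t = s (tlen t) m t" if "tlen t \<le> k" for k m t
    using that by (induction k rule: dec_induct) (simp_all add: step)
  have s_adm: "adm_BM (s k m)" for k m
    by (induction k) (auto simp: s_0 s_Suc adm intro!: adm_BM_gen_id adm_BM_add adm_BM_bimod_ext)
  have s_hom: "homog (tdeg degc degm) (degm m) (s k m)" for k m
  proof (induction k)
    case 0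
    show ?case unfolding s_0 by (rule homog_gen_diag) (simp add: homog_def)
  next
    case (Suc k)
    have "homog (tdeg degc degm) (degm m + 0) (bimod_ext degc 0 \<nu> (s k m))"
      by (rule homog_bimod_ext [OF Suc]) (simp add: hom)
    then show ?case unfolding s_Suc
      by (intro homog_add homog_gen_diag) (simp_all add: homog_def)
  qed
  \<comment> \<open>Each coordinate is read at an index from which on the partial sums no longer
    change it.\<close>
  define \<sigma> where "\<sigma> m t = s (tlen t) m t" for m t
  show thesis
  proof
    fix m
    show "adm_BM (\<sigma> m)"
    proof (rule adm_BM_subsetI, intro exI conjI allI impI)
      \<comment> \<open>For fixed word lengths a single partial sum gives all the coordinates, so
        its admissibility is inherited.\<close>
      fix i j show "finite {(u, n, v). length u = i \<and> length v = j \<and> s (i + j) m (u, n, v) \<noteq> 0}"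
        by (rule adm_BM_finite [OF s_adm])
    qed (auto simp: \<sigma>_def tlen_def)
    show "homog (tdeg degc degm) (degm m) (\<sigma> m)"
      using s_hom unfolding homog_def \<sigma>_def by blast
    show "\<sigma> m = (\<lambda>t. gen_id m t + bimod_ext degc 0 \<nu> (\<sigma> m) t)"
    proof
      fix t
      have "\<sigma> m t = s (Suc (tlen t)) m t" by (simp add: \<sigma>_def step)
      also have "\<dots> = gen_id m t + bimod_ext degc 0 \<nu> (s (tlen t) m) t" by (simp add: s_Suc)
      also have "bimod_ext degc 0 \<nu> (s (tlen t) m) t = bimod_ext degc 0 \<nu> (\<sigma> m) t"
        by (rule bimod_ext_local) (simp_all add: \<nu> \<sigma>_def stable [OF less_imp_le])
      finally show "\<sigma> m t = gen_id m t + bimod_ext degc 0 \<nu> (\<sigma> m) t" .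
    qed
  qed
qed

section \<open>The differential\<close>

definition diff_left :: "('c \<Rightarrow> int) \<Rightarrow> ('c \<Rightarrow> 'c list \<Rightarrow> 'k::field)
    \<Rightarrow> (('c list \<times> 'm \<times> 'c list) \<Rightarrow> 'k) \<Rightarrow> (('c list \<times> 'm \<times> 'c list) \<Rightarrow> 'k)" where
  "diff_left degc d x = (\<lambda>(u', m, v').
     \<Sum>(u, v, z)\<in>splits3 u'. ksign (wdeg degc u) * pairing (\<lambda>c. x (u @ [c] @ z, m, v')) (\<lambda>c. d c v))"

definition diff_right :: "('c \<Rightarrow> int) \<Rightarrow> ('m \<Rightarrow> int) \<Rightarrow> ('c \<Rightarrow> 'c list \<Rightarrow> 'k::field)
    \<Rightarrow> (('c list \<times> 'm \<times> 'c list) \<Rightarrow> 'k) \<Rightarrow> (('c list \<times> 'm \<times> 'c list) \<Rightarrow> 'k)" where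
  "diff_right degc degm d x = (\<lambda>(u', m, v').
     \<Sum>(u, v, z)\<in>splits3 v'. ksign (wdeg degc u' + degm m + wdeg degc u) *
       pairing (\<lambda>c. x (u', m, u @ [c] @ z)) (\<lambda>c. d c v))"

lemma diff_left_apply: "diff_left degc d x (u', m, v') =
  (\<Sum>(u, v, z)\<in>splits3 u'. ksign (wdeg degc u) * pairing (\<lambda>c. x (u @ [c] @ z, m, v')) (\<lambda>c. d c v))"
  by (simp add: diff_left_def)

lemma diff_right_apply: "diff_right degc degm d x (u', m, v') =
  (\<Sum>(u, v, z)\<in>splits3 v'. ksign (wdeg degc u' + degm m + wdeg degc u) *
       pairing (\<lambda>c. x (u', m, u @ [c] @ z)) (\<lambda>c. d c v))"
  by (simp add: diff_right_def)

text \<open>The middle summand is an odd bimodule map; the derivation behaviour is confined to the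
  outer two, which act on letters through \<open>d\<close>.\<close>

lemma DMext_eq:
  "DMext degc degm d dM x t
     = diff_left degc d x t + bimod_ext degc 1 dM x t + diff_right degc degm d x t"
  by (cases t)
    (simp add: DMext_def diff_left_apply diff_right_apply bimod_ext_apply splits_def splits3_def
      pairing_def sum_distrib_left mult.assoc)

lemma diff_left_nonzeroE:
  assumes "diff_left degc d x (u', m, v') \<noteq> 0"
  obtains u v z c where "u' = u @ v @ z" "x (u @ [c] @ z, m, v') \<noteq> 0" "d c v \<noteq> 0"
proof -
  obtain t where t: "t \<in> splits3 u'" and nz: "(case t of (u, v, z) \<Rightarrow>
      ksign (wdeg degc u) * pairing (\<lambda>c. x (u @ [c] @ z, m, v')) (\<lambda>c. d c v)) \<noteq> 0"
    using assms unfolding diff_left_apply by (rule sum.not_neutral_contains_not_neutral)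
  obtain u v z where uvz: "t = (u, v, z)" by (cases t)
  have "pairing (\<lambda>c. x (u @ [c] @ z, m, v')) (\<lambda>c. d c v) \<noteq> 0"
    using nz by (auto simp: uvz)
  then obtain c where "x (u @ [c] @ z, m, v') \<noteq> 0" "d c v \<noteq> 0"
    by (rule pairing_nonzeroE)
  then show thesis using that t by (auto simp: splits3_def uvz)
qed

lemma diff_right_nonzeroE:
  assumes "diff_right degc degm d x (u', m, v') \<noteq> 0"
  obtains u v z c where "v' = u @ v @ z" "x (u', m, u @ [c] @ z) \<noteq> 0" "d c v \<noteq> 0"
proof -
  obtain t where t: "t \<in> splits3 v'" and nz: "(case t of (u, v, z) \<Rightarrow>
      ksign (wdeg degc u' + degm m + wdeg degc u) * pairing (\<lambda>c. x (u', m, u @ [c] @ z)) (\<lambda>c. d c v)) \<noteq> 0"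
    using assms unfolding diff_right_apply by (rule sum.not_neutral_contains_not_neutral)
  obtain u v z where uvz: "t = (u, v, z)" by (cases t)
  have "pairing (\<lambda>c. x (u', m, u @ [c] @ z)) (\<lambda>c. d c v) \<noteq> 0"
    using nz by (auto simp: uvz)
  then obtain c where "x (u', m, u @ [c] @ z) \<noteq> 0" "d c v \<noteq> 0"
    by (rule pairing_nonzeroE)
  then show thesis using that t by (auto simp: splits3_def uvz)
qed

lemma adm_B_finite_le:
  assumes "adm_B x" shows "finite {w. length w \<le> n \<and> x w \<noteq> 0}"
proof (rule finite_subset)
  show "{w. length w \<le> n \<and> x w \<noteq> 0} \<subseteq> (\<Union>k\<in>{..n}. {w. length w = k \<and> x w \<noteq> 0})"
    by auto
  show "finite (\<Union>k\<in>{..n}. {w. length w = k \<and> x w \<noteq> 0})"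
    using assms by (auto simp: adm_B_def)
qed

lemma diff_left_zero [simp]: "diff_left degc d (\<lambda>_. 0) = (\<lambda>_. 0)"
  by (intro ext) (auto simp: diff_left_def)

lemma diff_right_zero [simp]: "diff_right degc degm d (\<lambda>_. 0) = (\<lambda>_. 0)"
  by (intro ext) (auto simp: diff_right_def)

lemma diff_left_add:
  assumes "adm_BM x" "adm_BM y"
  shows "diff_left degc d (\<lambda>t. x t + y t) t = diff_left degc d x t + diff_left degc d y t"
  using pairing_add_left [OF fin_supp_slice_left [OF assms(1)] fin_supp_slice_left [OF assms(2)]]
  by (cases t) (simp add: diff_left_apply distrib_left sum.distrib case_prod_beta)

lemma diff_right_add:
  assumes "adm_BM x" "adm_BM y"
  shows "diff_right degc degm d (\<lambda>t. x t + y t) t = diff_right degc degm d x t + diff_right degc degm d y t"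
  using pairing_add_left [OF fin_supp_slice_right [OF assms(1)] fin_supp_slice_right [OF assms(2)]]
  by (cases t) (simp add: diff_right_apply distrib_left sum.distrib case_prod_beta)

lemma diff_left_uminus: "diff_left degc d (\<lambda>t. - x t) t = - diff_left degc d x t"
  by (cases t) (simp add: diff_left_apply pairing_uminus_left sum_negf case_prod_beta)

lemma diff_right_uminus: "diff_right degc degm d (\<lambda>t. - x t) t = - diff_right degc degm d x t"
  by (cases t) (simp add: diff_right_apply pairing_uminus_left sum_negf case_prod_beta)

lemma DMext_zero [simp]: "DMext degc degm d dM (\<lambda>_. 0) = (\<lambda>_. 0)"
  by (intro ext) (simp add: DMext_eq)

lemma DMext_uminus: "DMext degc degm d dM (\<lambda>t. - x t) = (\<lambda>t. - DMext degc degm d dM x t)"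
  by (intro ext) (simp add: DMext_eq diff_left_uminus diff_right_uminus bimod_ext_uminus)

lemma DMext_add:
  assumes "adm_BM x" "adm_BM y"
  shows "DMext degc degm d dM (\<lambda>t. x t + y t)
      = (\<lambda>t. DMext degc degm d dM x t + DMext degc degm d dM y t)"
  by (intro ext) (simp add: DMext_eq diff_left_add diff_right_add bimod_ext_add assms)

lemma DMext_diff:
  assumes "adm_BM x" "adm_BM y"
  shows "DMext degc degm d dM (\<lambda>t. x t - y t)
      = (\<lambda>t. DMext degc degm d dM x t - DMext degc degm d dM y t)"
  using DMext_add [OF assms(1) adm_BM_uminus [OF assms(2)], of degc degm d dM]
  by (simp add: DMext_uminus)

section \<open>Finiteness and signs of the letter parts\<close>

locale graded_cogenerators =
  fixes degc :: "'c \<Rightarrow> int" and d :: "'c \<Rightarrow> 'c list \<Rightarrow> 'k::field"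
  assumes d_adm: "adm_B (d c)" and d_homog: "homog (wdeg degc) (degc c + 1) (d c)"
    and d_Nil: "d c [] = 0"
begin

text \<open>Since \<open>d c []\<close> vanishes, replacing a letter never shortens a word. Output
  lengths therefore bound input lengths, and finitely many entries of \<open>x\<close>
  matter.\<close>

lemma adm_BM_diff_left:
  fixes x :: "'c list \<times> 'm \<times> 'c list \<Rightarrow> 'k"
  assumes x: "adm_BM x" shows "adm_BM (diff_left degc d x)"
proof (rule adm_BM_subsetI, intro exI conjI allI impI)
  fix i j
  let ?X = "{(w, m, v). length w \<le> i \<and> length v \<le> j \<and> x (w, m, v) \<noteq> 0}"
  let ?f = "\<lambda>w m v k r. (take k w @ r @ drop (Suc k) w, m, v)"
  let ?A = "\<Union>(w, m, v)\<in>?X. \<Union>k\<in>{..<length w}. ?f w m v k ` {r. length r \<le> i \<and> d (w ! k) r \<noteq> 0}"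
  show "finite ?A"
    using adm_BM_finite_le [OF x, of i j] adm_B_finite_le [OF d_adm] by auto
  fix u' m v'
  assume len: "length u' = i" "length v' = j" and nz: "diff_left degc d x (u', m, v') \<noteq> 0"
  obtain u v z c where *: "u' = u @ v @ z" "x (u @ [c] @ z, m, v') \<noteq> 0" "d c v \<noteq> 0"
    using nz by (rule diff_left_nonzeroE)
  have "v \<noteq> []" using * d_Nil by metis
  then have X: "(u @ [c] @ z, m, v') \<in> ?X" using * len by (cases v) auto
  have img: "(u', m, v') \<in> ?f (u @ [c] @ z) m v' (length u) `
      {r. length r \<le> i \<and> d ((u @ [c] @ z) ! length u) r \<noteq> 0}"
    by (rule image_eqI [of _ _ v]) (use * len in simp_all)
  have k: "length u \<in> {..<length (u @ [c] @ z)}" by simp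
  show "(u', m, v') \<in> ?A"
    by (rule UN_I [OF X], unfold prod.case) (rule UN_I, rule k, rule img)
qed

lemma adm_BM_diff_right:
  fixes x :: "'c list \<times> 'm \<times> 'c list \<Rightarrow> 'k"
  assumes x: "adm_BM x" shows "adm_BM (diff_right degc degm d x)"
proof (rule adm_BM_subsetI, intro exI conjI allI impI)
  fix i j
  let ?X = "{(v, m, w). length v \<le> i \<and> length w \<le> j \<and> x (v, m, w) \<noteq> 0}"
  let ?f = "\<lambda>w m v k r. (v, m, take k w @ r @ drop (Suc k) w)"
  let ?A = "\<Union>(v, m, w)\<in>?X. \<Union>k\<in>{..<length w}. ?f w m v k ` {r. length r \<le> j \<and> d (w ! k) r \<noteq> 0}"
  show "finite ?A"
    using adm_BM_finite_le [OF x, of i j] adm_B_finite_le [OF d_adm] by auto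
  fix u' m v'
  assume len: "length u' = i" "length v' = j" and nz: "diff_right degc degm d x (u', m, v') \<noteq> 0"
  obtain u v z c where *: "v' = u @ v @ z" "x (u', m, u @ [c] @ z) \<noteq> 0" "d c v \<noteq> 0"
    using nz by (rule diff_right_nonzeroE)
  have "v \<noteq> []" using * d_Nil by metis
  then have X: "(u', m, u @ [c] @ z) \<in> ?X" using * len by (cases v) auto
  have img: "(u', m, v') \<in> ?f (u @ [c] @ z) m u' (length u) `
      {r. length r \<le> j \<and> d ((u @ [c] @ z) ! length u) r \<noteq> 0}"
    by (rule image_eqI [of _ _ v]) (use * len in simp_all)
  have k: "length u \<in> {..<length (u @ [c] @ z)}" by simp
  show "(u', m, v') \<in> ?A"
    by (rule UN_I [OF X], unfold prod.case) (rule UN_I, rule k, rule img)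
qed

lemma adm_BM_DMext:
  assumes "adm_BM x" "\<And>m. adm_BM (dM m)"
  shows "adm_BM (DMext degc degm d dM x)"
proof -
  have "DMext degc degm d dM x
      = (\<lambda>t. diff_left degc d x t + bimod_ext degc 1 dM x t + diff_right degc degm d x t)"
    by (intro ext) (rule DMext_eq)
  then show ?thesis
    using assms by (auto intro!: adm_BM_add adm_BM_diff_left adm_BM_diff_right adm_BM_bimod_ext)
qed

text \<open>No coalgebra component ends in the empty word, so on empty words only the lowest
  component of \<open>dM\<close> survives.\<close>

lemma DMext_00: "DMext degc degm d dM x ([], m, []) = comp00 dM (\<lambda>m. x ([], m, [])) m"
proof -
  have "diff_left degc d x ([], m, []) = 0"
    by (auto simp: diff_left_apply splits3_def d_Nil)
  moreover have "diff_right degc degm d x ([], m, []) = 0"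
    by (auto simp: diff_right_apply splits3_def d_Nil)
  ultimately show ?thesis by (simp add: DMext_eq bimod_ext_00)
qed

lemma ksign_wdeg_d:
  assumes "d c v \<noteq> 0"
  shows "ksign (wdeg degc (u @ [c] @ z)) = (- ksign (wdeg degc (u @ v @ z)) :: 'k)"
proof -
  have "wdeg degc v = degc c + 1" using d_homog assms by (auto simp: homog_def)
  then have "wdeg degc (u @ v @ z) = wdeg degc (u @ [c] @ z) + 1" by simp
  then show ?thesis by (simp only: ksign_add_1 minus_minus)
qed

text \<open>The odd extension carries the sign of the left word, and \<open>d\<close> changes the
  degree of that word by one.\<close>

lemma diff_left_anticommute:
  assumes x: "adm_BM x"
  shows "diff_left degc d (bimod_ext degc 1 (gen_diag h) x) t = - bimod_ext degc 1 (gen_diag h) (diff_left degc d x) t"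
proof -
  obtain u' n v' where t: "t = (u', n, v')" by (cases t)
  define P where "P u v z = pairing (\<lambda>c. pairing (\<lambda>m. x (u @ [c] @ z, m, v')) (\<lambda>m. h m n)) (\<lambda>c. d c v)" for u v z
  have 1: "pairing (\<lambda>c. bimod_ext degc 1 (gen_diag h) x (u @ [c] @ z, n, v')) (\<lambda>c. d c v)
      = - ksign (wdeg degc (u @ v @ z)) * P u v z" for u v z
  proof -
    \<comment> \<open>The sign depends on the summation letter. Moved next to \<open>d c v\<close>
      it becomes constant, as \<open>d c v\<close> is nonzero for one degree of \<open>c\<close>
      only.\<close>
    have "pairing (\<lambda>c. ksign (wdeg degc (u @ [c] @ z)) * pairing (\<lambda>m. x (u @ [c] @ z, m, v')) (\<lambda>m. h m n)) (\<lambda>c. d c v)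
      = pairing (\<lambda>c. pairing (\<lambda>m. x (u @ [c] @ z, m, v')) (\<lambda>m. h m n)) (\<lambda>c. ksign (wdeg degc (u @ [c] @ z)) * d c v)"
      by (simp add: pairing_def mult_ac)
    also have "(\<lambda>c. ksign (wdeg degc (u @ [c] @ z)) * d c v) = (\<lambda>c. - ksign (wdeg degc (u @ v @ z)) * d c v)"
    proof
      fix c show "ksign (wdeg degc (u @ [c] @ z)) * d c v = - ksign (wdeg degc (u @ v @ z)) * d c v"
        by (cases "d c v = 0") (simp_all only: ksign_wdeg_d mult_zero_right)
    qed
    finally show ?thesis unfolding pairing_cmult_right P_def
      by (simp only: bimod_ext_gen_diag mult_1)
  qed
  have 2: "bimod_ext degc 1 (gen_diag h) (diff_left degc d x) t
      = ksign (wdeg degc u') * (\<Sum>(u, v, z)\<in>splits3 u'. ksign (wdeg degc u) * P u v z)"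
  proof -
    have "pairing (\<lambda>m. diff_left degc d x (u', m, v')) (\<lambda>m. h m n)
        = (\<Sum>(u, v, z)\<in>splits3 u'. pairing (\<lambda>m. ksign (wdeg degc u) *
            pairing (\<lambda>c. x (u @ [c] @ z, m, v')) (\<lambda>c. d c v)) (\<lambda>m. h m n))"
      unfolding diff_left_apply case_prod_beta
    proof (rule pairing_sum_left)
      fix i
      show "fin_supp (\<lambda>m. ksign (wdeg degc (fst i)) *
          pairing (\<lambda>c. x (fst i @ [c] @ snd (snd i), m, v')) (\<lambda>c. d c (fst (snd i))))"
        by (intro fin_supp_cmult fin_supp_pairing_left finite_slice_left x)
    qed
    also have "\<dots> = (\<Sum>(u, v, z)\<in>splits3 u'. ksign (wdeg degc u) * P u v z)"
      unfolding pairing_cmult_left P_def pairing_swap [OF finite_slice_left [OF x]] ..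
    finally show ?thesis by (simp add: t bimod_ext_gen_diag)
  qed
  show ?thesis
    unfolding 2 unfolding t diff_left_apply 1 sum_distrib_left sum_negf [symmetric]
    by (intro sum.cong refl) (auto simp: splits3_def)
qed

text \<open>Here the left word is untouched. The minus sign comes from the generator:
  \<open>h\<close> lowers its degree by one, and its parity enters the sign of
  \<open>diff_right\<close>.\<close>

lemma diff_right_anticommute:
  assumes x: "adm_BM x" and h: "\<And>m. homog degn (degm m - 1) (h m)"
  shows "diff_right degc degn d (bimod_ext degc 1 (gen_diag h) x) t
      = - bimod_ext degc 1 (gen_diag h) (diff_right degc degm d x) t"
proof -
  obtain u' n v' where t: "t = (u', n, v')" by (cases t)
  define P where "P u v z = pairing (\<lambda>c. pairing (\<lambda>m. x (u', m, u @ [c] @ z)) (\<lambda>m. h m n)) (\<lambda>c. d c v)" for u v z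
  have 1: "pairing (\<lambda>c. bimod_ext degc 1 (gen_diag h) x (u', n, u @ [c] @ z)) (\<lambda>c. d c v)
      = ksign (wdeg degc u') * P u v z" for u v z
    by (simp only: bimod_ext_gen_diag mult_1 pairing_cmult_left P_def)
  have 2: "bimod_ext degc 1 (gen_diag h) (diff_right degc degm d x) t
      = ksign (wdeg degc u') * (\<Sum>(u, v, z)\<in>splits3 v'. - ksign (wdeg degc u' + degn n + wdeg degc u) * P u v z)"
  proof -
    have "pairing (\<lambda>m. diff_right degc degm d x (u', m, v')) (\<lambda>m. h m n)
        = (\<Sum>(u, v, z)\<in>splits3 v'. pairing (\<lambda>m. ksign (wdeg degc u' + degm m + wdeg degc u) *
            pairing (\<lambda>c. x (u', m, u @ [c] @ z)) (\<lambda>c. d c v)) (\<lambda>m. h m n))"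
      unfolding diff_right_apply case_prod_beta
    proof (rule pairing_sum_left)
      fix i
      show "fin_supp (\<lambda>m. ksign (wdeg degc u' + degm m + wdeg degc (fst i)) *
          pairing (\<lambda>c. x (u', m, fst i @ [c] @ snd (snd i))) (\<lambda>c. d c (fst (snd i))))"
        using fin_supp_pairing_left [OF finite_slice_right [OF x], of u' "fst i" "snd (snd i)"]
        unfolding fin_supp_def by (rule rev_finite_subset) auto
    qed
    also have "\<dots> = (\<Sum>(u, v, z)\<in>splits3 v'. - ksign (wdeg degc u' + degn n + wdeg degc u) * P u v z)"
    proof (intro sum.cong refl, clarify)
      fix u v z
      have "pairing (\<lambda>m. ksign (wdeg degc u' + degm m + wdeg degc u) *
            pairing (\<lambda>c. x (u', m, u @ [c] @ z)) (\<lambda>c. d c v)) (\<lambda>m. h m n)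
         = pairing (\<lambda>m. pairing (\<lambda>c. x (u', m, u @ [c] @ z)) (\<lambda>c. d c v))
            (\<lambda>m. ksign (wdeg degc u' + degm m + wdeg degc u) * h m n)"
        by (simp add: pairing_def mult_ac)
      also have "(\<lambda>m. ksign (wdeg degc u' + degm m + wdeg degc u) * h m n)
         = (\<lambda>m. - ksign (wdeg degc u' + degn n + wdeg degc u) * h m n)"
      proof
        fix m
        show "ksign (wdeg degc u' + degm m + wdeg degc u) * h m n
            = - ksign (wdeg degc u' + degn n + wdeg degc u) * h m n"
        proof (cases "h m n = 0")
          case False
          then have "wdeg degc u' + degm m + wdeg degc u = (wdeg degc u' + degn n + wdeg degc u) + 1"
            using h [of m] by (auto simp: homog_def)
          then show ?thesis by (simp only: ksign_add_1)
        qed simp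
      qed
      also have "pairing (\<lambda>m. pairing (\<lambda>c. x (u', m, u @ [c] @ z)) (\<lambda>c. d c v))
            (\<lambda>m. - ksign (wdeg degc u' + degn n + wdeg degc u) * h m n)
         = - ksign (wdeg degc u' + degn n + wdeg degc u) * P u v z"
        unfolding pairing_cmult_right P_def pairing_swap [OF finite_slice_right [OF x]] ..
      finally show "pairing (\<lambda>m. ksign (wdeg degc u' + degm m + wdeg degc u) *
            pairing (\<lambda>c. x (u', m, u @ [c] @ z)) (\<lambda>c. d c v)) (\<lambda>m. h m n)
         = - ksign (wdeg degc u' + degn n + wdeg degc u) * P u v z" .
    qed
    finally show ?thesis by (simp add: t bimod_ext_gen_diag)
  qed
  show ?thesis
    unfolding 2 unfolding t diff_right_apply 1 sum_distrib_left sum_negf [symmetric]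
    by (intro sum.cong refl) (auto simp: mult_ac)
qed

end

section \<open>Contracting homotopies of acyclic complexes\<close>

definition lin_ext :: "('a \<Rightarrow> 'b \<Rightarrow> 'k::field) \<Rightarrow> ('a \<Rightarrow> 'k) \<Rightarrow> 'b \<Rightarrow> 'k" where
  "lin_ext D x = (\<lambda>b. pairing x (\<lambda>a. D a b))"

lemma fin_supp_lin_ext: "fin_supp x \<Longrightarrow> (\<And>a. fin_supp (D a)) \<Longrightarrow> fin_supp (lin_ext D x)"
  unfolding lin_ext_def by (rule fin_supp_pairing)

definition deg_part :: "('a \<Rightarrow> int) \<Rightarrow> int \<Rightarrow> ('a \<Rightarrow> 'k::field) \<Rightarrow> 'a \<Rightarrow> 'k" where
  "deg_part deg n x = (\<lambda>a. if deg a = n then x a else 0)"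

lemma fin_supp_deg_part: "fin_supp x \<Longrightarrow> fin_supp (deg_part deg n x)"
  unfolding fin_supp_def deg_part_def by (rule rev_finite_subset) auto

lemma homog_deg_part: "homog deg n (deg_part deg n x)"
  by (simp add: homog_def deg_part_def)

lemma sum_deg_part:
  assumes "fin_supp x"
  shows "(\<Sum>n\<in>deg ` {a. x a \<noteq> 0}. deg_part deg n x a) = x a"
proof -
  have "(\<Sum>n\<in>deg ` {a. x a \<noteq> 0}. deg_part deg n x a)
      = (\<Sum>n\<in>deg ` {a. x a \<noteq> 0}. if n = deg a then x a else 0)"
    by (intro sum.cong) (auto simp: deg_part_def)
  then show ?thesis using assms by (auto simp: fin_supp_def)
qed

lemma lin_ext_deg_part:
  assumes "fin_supp x" "\<And>a. homog deg (deg a + 1) (D a)"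
  shows "lin_ext D (deg_part deg n x) = deg_part deg (n + 1) (lin_ext D x)"
proof
  fix b
  let ?S = "{a. x a \<noteq> 0}"
  have S: "finite ?S" using assms(1) by (simp add: fin_supp_def)
  have 0: "D a b = 0" if "deg b \<noteq> deg a + 1" for a
    using assms(2) [of a] that by (auto simp: homog_def)
  have "lin_ext D (deg_part deg n x) b = (\<Sum>a\<in>?S. deg_part deg n x a * D a b)"
    unfolding lin_ext_def by (rule pairing_superset [OF S]) (auto simp: deg_part_def)
  also have "\<dots> = (\<Sum>a\<in>?S. if deg b = n + 1 then x a * D a b else 0)"
    by (intro sum.cong) (auto simp: deg_part_def 0)
  also have "\<dots> = deg_part deg (n + 1) (lin_ext D x) b"
    by (simp add: lin_ext_def pairing_def deg_part_def)
  finally show "lin_ext D (deg_part deg n x) b = deg_part deg (n + 1) (lin_ext D x) b" .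
qed

text \<open>Acyclicity is given for homogeneous cycles. A finitely supported cycle has finitely many
  homogeneous parts, each again a cycle, and their primitives add up.\<close>

lemma ungraded_acyclic:
  assumes D: "\<And>a. homog deg (deg a + 1) (D a)"
    and acyc: "\<And>n x. x \<in> cycles fin_supp deg (lin_ext D) n \<Longrightarrow> x \<in> bdries fin_supp deg (lin_ext D) n"
    and x: "fin_supp x" "lin_ext D x = (\<lambda>_. 0)"
  obtains y where "fin_supp y" "lin_ext D y = x"
proof -
  have "\<exists>y. fin_supp y \<and> lin_ext D y = deg_part deg n x" for n
  proof -
    have "lin_ext D (deg_part deg n x) = (\<lambda>_. 0)"
      by (simp add: lin_ext_deg_part x D) (simp add: deg_part_def)
    then have "deg_part deg n x \<in> cycles fin_supp deg (lin_ext D) n"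
      by (simp add: cycles_def fin_supp_deg_part x homog_deg_part)
    from acyc [OF this] show ?thesis by (auto simp: bdries_def)
  qed
  then obtain y where y: "\<And>n. fin_supp (y n)" "\<And>n. lin_ext D (y n) = deg_part deg n x"
    by metis
  show thesis
  proof
    show "fin_supp (\<lambda>a. \<Sum>n\<in>deg ` {a. x a \<noteq> 0}. y n a)" by (intro fin_supp_sum y)
    show "lin_ext D (\<lambda>a. \<Sum>n\<in>deg ` {a. x a \<noteq> 0}. y n a) = x"
    proof
      fix b
      have "lin_ext D (\<lambda>a. \<Sum>n\<in>deg ` {a. x a \<noteq> 0}. y n a) b
          = (\<Sum>n\<in>deg ` {a. x a \<noteq> 0}. lin_ext D (y n) b)"
        unfolding lin_ext_def by (intro pairing_sum_left y)
      then show "lin_ext D (\<lambda>a. \<Sum>n\<in>deg ` {a. x a \<noteq> 0}. y n a) b = x b"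
        by (simp add: y sum_deg_part x)
    qed
  qed
qed

text \<open>A linear section \<open>g\<close> of the differential onto its image yields the contraction
  \<open>p \<mapsto> g (p - g (D p))\<close>.\<close>
lemma ungraded_contraction:
  fixes D :: "'a \<Rightarrow> 'a \<Rightarrow> 'k::field"
  assumes fin: "\<And>a. fin_supp (D a)"
    and DD: "\<And>x. fin_supp x \<Longrightarrow> lin_ext D (lin_ext D x) = (\<lambda>_. 0)"
    and acyc: "\<And>x. fin_supp x \<Longrightarrow> lin_ext D x = (\<lambda>_. 0) \<Longrightarrow> \<exists>y. fin_supp y \<and> lin_ext D y = x"
  obtains h where "\<And>a. fin_supp (h a)"
    "\<And>a b. pairing (h a) (\<lambda>c. D c b) + pairing (D a) (\<lambda>c. h c b) = (if b = a then 1 else 0)"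
proof -
  \<comment> \<open>Finitely supported functions become a type of their own here, a vector space to
    which the existence of linear right inverses applies.\<close>
  define sc :: "'k \<Rightarrow> ('a \<Rightarrow>\<^sub>0 'k) \<Rightarrow> ('a \<Rightarrow>\<^sub>0 'k)"
    where "sc s p = Abs_poly_mapping (\<lambda>a. s * Poly_Mapping.lookup p a)" for s p
  have fs: "fin_supp (Poly_Mapping.lookup p)" for p :: "'a \<Rightarrow>\<^sub>0 'k"
    unfolding fin_supp_def by (rule finite_lookup)
  have sc: "Poly_Mapping.lookup (sc s p) a = s * Poly_Mapping.lookup p a" for s p a
    using fin_supp_cmult [OF fs] by (simp add: sc_def fin_supp_def)
  interpret vector_space_pair sc sc
    by unfold_locales (auto intro!: poly_mapping_eqI simp: sc lookup_add algebra_simps)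
  define L where "L p = Abs_poly_mapping (lin_ext D (Poly_Mapping.lookup p))" for p
  have L: "Poly_Mapping.lookup (L p) = lin_ext D (Poly_Mapping.lookup p)" for p
    using fin_supp_lin_ext [OF fs fin] by (simp add: L_def fin_supp_def)
  have lin_L: "Vector_Spaces.linear sc sc L"
  proof unfold_locales
    fix p q :: "'a \<Rightarrow>\<^sub>0 'k" and s :: 'k
    have "Poly_Mapping.lookup (p + q) = (\<lambda>a. Poly_Mapping.lookup p a + Poly_Mapping.lookup q a)"
      by (auto simp: lookup_add)
    then show "L (p + q) = L p + L q"
      by (intro poly_mapping_eqI) (simp add: L lookup_add lin_ext_def pairing_add_left fs)
    have "Poly_Mapping.lookup (sc s p) = (\<lambda>a. s * Poly_Mapping.lookup p a)"
      by (auto simp: sc)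
    then show "L (sc s p) = sc s (L p)"
      by (intro poly_mapping_eqI) (simp add: L sc lin_ext_def pairing_cmult_left)
  qed
  obtain g where lin_g: "Vector_Spaces.linear sc sc g" and g: "\<And>v. v \<in> range L \<Longrightarrow> L (g v) = v"
    using linear_exists_right_inverse_on [OF lin_L vs1.subspace_UNIV] by blast
  interpret L: Vector_Spaces.linear sc sc L by (rule lin_L)
  interpret g: Vector_Spaces.linear sc sc g by (rule lin_g)
  define H where "H p = g (p - g (L p))" for p
  have LL: "L (L p) = 0" for p
    by (rule poly_mapping_eqI) (simp add: L DD fs)
  have range: "p \<in> range L" if "L p = 0" for p
  proof -
    have "lin_ext D (Poly_Mapping.lookup p) = (\<lambda>_. 0)" 
      by (rule ext) (metis L lookup_zero that)
    then obtain y where y: "fin_supp y" "lin_ext D y = Poly_Mapping.lookup p" using acyc [OF fs] by blast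
    have "L (Abs_poly_mapping y) = p"
      by (rule poly_mapping_eqI) (use y in \<open>simp add: L fin_supp_def\<close>)
    then show ?thesis by blast
  qed
  \<comment> \<open>\<open>L (g (L p)) = L p\<close> by the choice of \<open>g\<close>, so
    \<open>p - g (L p)\<close> is a cycle. By acyclicity it lies in the range of \<open>L\<close>,
    where \<open>g\<close> is a right inverse.\<close>
  have "L (p - g (L p)) = 0" for p by (simp add: L.diff g)
  then have 1: "L (H p) = p - g (L p)" for p unfolding H_def by (rule g [OF range])
  have 2: "H (L p) = g (L p)" for p by (simp add: H_def LL)
  have LH: "L (H p) + H (L p) = p" for p by (simp add: 1 2)
  have H_add: "H (p + q) = H p + H q" for p q
    by (simp add: H_def L.add g.add g.diff)
  have H_sc: "H (sc s p) = sc s (H p)" for s p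
    by (simp add: H_def L.scale g.scale g.diff vs1.scale_right_diff_distrib)
  have H_sum: "H (\<Sum>i\<in>I. p i) = (\<Sum>i\<in>I. H (p i))" if "finite I" for I and p :: "'a \<Rightarrow> 'a \<Rightarrow>\<^sub>0 'k"
    using that by (induction I) (simp_all add: H_add, simp add: H_def)
  \<comment> \<open>Expansion in the basis of single generators, which turns the linear map
    \<open>H\<close> back into a matrix \<open>h\<close>.\<close>
  have expand: "q = (\<Sum>c\<in>Poly_Mapping.keys q. sc (Poly_Mapping.lookup q c) (Poly_Mapping.single c 1))" for q
  proof (rule poly_mapping_eqI)
    fix a
    have "(\<Sum>c\<in>Poly_Mapping.keys q. Poly_Mapping.lookup q c * Poly_Mapping.lookup (Poly_Mapping.single c 1) a)
        = (\<Sum>c\<in>Poly_Mapping.keys q. if c = a then Poly_Mapping.lookup q c else 0)"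
      by (intro sum.cong) (auto simp: lookup_single when_def)
    also have "\<dots> = Poly_Mapping.lookup q a" by (simp add: in_keys_iff)
    finally show "Poly_Mapping.lookup q a = Poly_Mapping.lookup (\<Sum>c\<in>Poly_Mapping.keys q. sc (Poly_Mapping.lookup q c) (Poly_Mapping.single c 1)) a"
      by (simp add: lookup_sum sc)
  qed
  define h where "h a = Poly_Mapping.lookup (H (Poly_Mapping.single a 1))" for a
  have H: "Poly_Mapping.lookup (H q) b = pairing (Poly_Mapping.lookup q) (\<lambda>c. h c b)" for q b
    by (subst expand, subst H_sum)
      (simp_all add: H_sc lookup_sum sc h_def pairing_def keys.rep_eq)
  show thesis
  proof
    show "fin_supp (h a)" for a by (simp add: h_def fs)
    fix a b :: 'a
    have sgl: "Poly_Mapping.lookup (Poly_Mapping.single a 1) = (\<lambda>b. if b = a then 1 else 0 :: 'k)"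
      by (auto simp: lookup_single when_def)
    have "L (Poly_Mapping.single a 1) = Abs_poly_mapping (D a)"
      unfolding L_def sgl lin_ext_def pairing_delta ..
    then have D: "Poly_Mapping.lookup (L (Poly_Mapping.single a 1)) = D a"
      using fin [of a] by (simp add: fin_supp_def)
    have "Poly_Mapping.lookup (L (H (Poly_Mapping.single a 1)) + H (L (Poly_Mapping.single a 1))) b = (if b = a then 1 else 0)"
      unfolding LH sgl ..
    then show "pairing (h a) (\<lambda>c. D c b) + pairing (D a) (\<lambda>c. h c b) = (if b = a then 1 else 0)"
      unfolding lookup_add H D unfolding L lin_ext_def by (simp only: h_def)
  qed
qed

text \<open>The identity has degree 0, so by comparison of degrees the degree -1 part of any
  contraction is again a contraction.\<close>

lemma graded_contraction:
  fixes D :: "'a \<Rightarrow> 'a \<Rightarrow> 'k::field"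
  assumes fin: "\<And>a. fin_supp (D a)" and hom: "\<And>a. homog deg (deg a + 1) (D a)"
    and DD: "\<And>x. fin_supp x \<Longrightarrow> lin_ext D (lin_ext D x) = (\<lambda>_. 0)"
    and acyc: "\<And>n x. x \<in> cycles fin_supp deg (lin_ext D) n \<Longrightarrow> x \<in> bdries fin_supp deg (lin_ext D) n"
  obtains h where "\<And>a. fin_supp (h a)" "\<And>a. homog deg (deg a - 1) (h a)"
    "\<And>a b. pairing (h a) (\<lambda>c. D c b) + pairing (D a) (\<lambda>c. h c b) = (if b = a then 1 else 0)"
proof -
  have "\<exists>y. fin_supp y \<and> lin_ext D y = x" if "fin_supp x" "lin_ext D x = (\<lambda>_. 0)" for x
    using ungraded_acyclic [OF hom acyc that] by metis
  then obtain H where H: "\<And>a. fin_supp (H a)"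
    "\<And>a b. pairing (H a) (\<lambda>c. D c b) + pairing (D a) (\<lambda>c. H c b) = (if b = a then 1 else 0)"
    using ungraded_contraction [OF fin DD] by metis
  define h where "h a = deg_part deg (deg a - 1) (H a)" for a
  show thesis
  proof
    show "fin_supp (h a)" for a unfolding h_def by (intro fin_supp_deg_part H)
    show "homog deg (deg a - 1) (h a)" for a unfolding h_def by (rule homog_deg_part)
    fix a b
    have "pairing (h a) (\<lambda>c. D c b) = lin_ext D (h a) b" by (simp add: lin_ext_def)
    also have "\<dots> = deg_part deg (deg a) (lin_ext D (H a)) b"
      by (simp add: h_def lin_ext_deg_part H hom)
    also have "\<dots> = (if deg b = deg a then pairing (H a) (\<lambda>c. D c b) else 0)"
      by (simp add: deg_part_def lin_ext_def)
    finally have 1: "pairing (h a) (\<lambda>c. D c b) = (if deg b = deg a then pairing (H a) (\<lambda>c. D c b) else 0)" .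
    have "pairing (D a) (\<lambda>c. h c b) = pairing (D a) (\<lambda>c. if deg b = deg a then H c b else 0)"
      using hom [of a] by (intro pairing_cong_right) (auto simp: h_def deg_part_def homog_def)
    then have 2: "pairing (D a) (\<lambda>c. h c b) = (if deg b = deg a then pairing (D a) (\<lambda>c. H c b) else 0)"
      by simp
    show "pairing (h a) (\<lambda>c. D c b) + pairing (D a) (\<lambda>c. h c b) = (if b = a then 1 else 0)"
      using H(2) [of a b] by (auto simp: 1 2)
  qed
qed

section \<open>Contracting homotopies of cobimodules\<close>

text \<open>If \<open>H\<^sub>0\<close> is the bimodule map extending a contraction of the (0,0)-part, then
  \<open>N = 1 - D H\<^sub>0 - H\<^sub>0 D\<close> commutes with \<open>D\<close> and strictly increases word length, so
  \<open>H = H\<^sub>0 (1 + N + N\<^sup>2 + \<dots>)\<close> satisfies \<open>D H + H D = 1\<close>.\<close>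
lemma (in graded_cogenerators) cobimod_contraction:
  fixes deg :: "'m \<Rightarrow> int" and dK :: "'m \<Rightarrow> ('c list \<times> 'm \<times> 'c list) \<Rightarrow> 'k"
  assumes K: "ainf_cobimod degc deg d dK"
    and h: "\<And>a. fin_supp (h a)" "\<And>a. homog deg (deg a - 1) (h a)"
    and contr: "\<And>a b. pairing (h a) (\<lambda>c. dK c ([], b, [])) + pairing (\<lambda>c. dK a ([], c, [])) (\<lambda>c. h c b)
      = (if b = a then 1 else 0)"
  obtains \<eta> where "\<And>a. adm_BM (\<eta> a)" "\<And>a. homog (tdeg degc deg) (deg a - 1) (\<eta> a)"
    "\<And>x t. adm_BM x \<Longrightarrow> DMext degc deg d dK (bimod_ext degc 1 \<eta> x) t
        + bimod_ext degc 1 \<eta> (DMext degc deg d dK x) t = x t"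
proof -
  let ?D = "DMext degc deg d dK"
  let ?E = "bimod_ext degc"
  have dK: "\<And>a. adm_BM (dK a)" "\<And>a. homog (tdeg degc deg) (deg a + 1) (dK a)"
    and DD: "\<And>x. adm_BM x \<Longrightarrow> ?D (?D x) = (\<lambda>_. 0)"
    using K by (auto simp: ainf_cobimod_def)
  define h' :: "'m \<Rightarrow> ('c list \<times> 'm \<times> 'c list) \<Rightarrow> 'k" where "h' = gen_diag h"
  have h': "adm_BM (h' a)" "homog (tdeg degc deg) (deg a - 1) (h' a)" for a
    unfolding h'_def by (intro adm_BM_gen_diag homog_gen_diag h)+
  \<comment> \<open>This is \<open>1 - D H0 - H0 D\<close> on generators, with only the
    \<open>dK\<close> part of the differential; the letter parts will cancel.\<close>
  define \<nu> where "\<nu> a = (\<lambda>t. gen_id a t - ?E 1 dK (h' a) t - ?E 1 h' (dK a) t)" for a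
  have \<nu>_adm: "adm_BM (\<nu> a)" for a
    unfolding \<nu>_def by (intro adm_BM_diff adm_BM_gen_id adm_BM_bimod_ext dK h')
  have \<nu>_hom: "homog (tdeg degc deg) (deg a) (\<nu> a)" for a
  proof -
    have "homog (tdeg degc deg) (deg a - 1 + 1) (?E 1 dK (h' a))"
      by (rule homog_bimod_ext [OF h'(2)]) (simp add: dK)
    moreover have "homog (tdeg degc deg) (deg a + 1 + - 1) (?E 1 h' (dK a))"
      by (rule homog_bimod_ext [OF dK(2)]) (simp add: h')
    ultimately show ?thesis unfolding \<nu>_def
      by (intro homog_diff homog_gen_diag) (simp_all add: homog_def)
  qed
  \<comment> \<open>The contraction identity enters here: the (0,0)-part of
    \<open>D H0 + H0 D\<close> is the identity, so what remains lengthens words.\<close>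
  have \<nu>_00: "\<nu> a ([], b, []) = 0" for a b
    using contr [of a b]
    by (simp add: \<nu>_def bimod_ext_00 comp00_eq h'_def gen_diag_apply algebra_simps)
  obtain \<sigma> where \<sigma>: "\<And>a. adm_BM (\<sigma> a)" "\<And>a. homog (tdeg degc deg) (deg a) (\<sigma> a)"
    "\<And>a. \<sigma> a = (\<lambda>t. gen_id a t + ?E 0 \<nu> (\<sigma> a) t)"
    using neumann_series [OF \<nu>_adm \<nu>_00 \<nu>_hom] by blast
  define N where "N = ?E 0 \<nu>"
  define S where "S = ?E 0 \<sigma>"
  define H0 where "H0 = ?E 1 h'"
  have N_adm: "adm_BM (N x)" and S_adm: "adm_BM (S x)" and H0_adm: "adm_BM (H0 x)"
    and D_adm: "adm_BM (?D x)" if "adm_BM x" for x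
    using that unfolding N_def S_def H0_def
    by (intro adm_BM_bimod_ext adm_BM_DMext \<nu>_adm \<sigma> h' dK; assumption)+
  \<comment> \<open>By anticommutation the letter parts of the two composites cancel.\<close>
  have N: "?D (H0 x) t + H0 (?D x) t = x t - N x t" if x: "adm_BM x" for x t
  proof -
    have D: "?D x = (\<lambda>t. diff_left degc d x t + ?E 1 dK x t + diff_right degc deg d x t)"
      by (intro ext) (rule DMext_eq)
    have adm: "adm_BM (diff_left degc d x)" "adm_BM (?E 1 dK x)" "adm_BM (diff_right degc deg d x)"
      using x by (auto intro!: adm_BM_diff_left adm_BM_diff_right adm_BM_bimod_ext dK)
    have HD: "H0 (?D x) t = H0 (diff_left degc d x) t + H0 (?E 1 dK x) t + H0 (diff_right degc deg d x) t"
      unfolding D H0_def by (simp add: bimod_ext_add adm_BM_add adm)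
    have DH: "?D (H0 x) t = - H0 (diff_left degc d x) t + ?E 1 dK (H0 x) t - H0 (diff_right degc deg d x) t"
      unfolding DMext_eq H0_def h'_def
      by (simp add: diff_left_anticommute [OF x] diff_right_anticommute [OF x h(2)])
    have id: "?E 0 gen_id x t = x t"
      by (cases t) (simp add: bimod_ext_gen_id x)
    have "N x t = x t - ?E 0 (\<lambda>a. ?E 1 dK (h' a)) x t - ?E 0 (\<lambda>a. ?E 1 h' (dK a)) x t"
      unfolding N_def \<nu>_def by (simp add: bimod_ext_diff_right id)
    \<comment> \<open>Two odd extensions compose to one of degree 2, whose signs are
      trivial.\<close>
    also have "?E 0 (\<lambda>a. ?E 1 dK (h' a)) x = ?E 1 dK (H0 x)"
      unfolding H0_def by (simp add: bimod_ext_comp x h' bimod_ext_even [of 2])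
    also have "?E 0 (\<lambda>a. ?E 1 h' (dK a)) x = H0 (?E 1 dK x)"
      unfolding H0_def by (simp add: bimod_ext_comp x dK bimod_ext_even [of 2])
    finally show ?thesis by (simp add: HD DH)
  qed
  have NE: "N x = (\<lambda>t. x t - ?D (H0 x) t - H0 (?D x) t)" if "adm_BM x" for x
  proof
    fix t show "N x t = x t - ?D (H0 x) t - H0 (?D x) t"
      using N [OF that, of t] by (simp add: algebra_simps)
  qed
  have H0_0: "H0 (\<lambda>_. 0) = (\<lambda>_. 0)" by (simp add: H0_def)
  \<comment> \<open>Both sides equal \<open>D - D H0 D\<close>, because
    \<open>D D = 0\<close>.\<close>
  have ND: "N (?D x) = ?D (N x)" if x: "adm_BM x" for x
  proof -
    have "N (?D x) = (\<lambda>t. ?D x t - ?D (H0 (?D x)) t)"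
      by (simp add: NE D_adm x DD H0_0)
    moreover have "?D (N x) = (\<lambda>t. ?D x t - ?D (H0 (?D x)) t)"
      by (simp add: NE x DMext_diff adm_BM_diff H0_adm D_adm DD)
    ultimately show ?thesis by simp
  qed
  have S: "S x = (\<lambda>t. x t + N (S x) t)" if x: "adm_BM x" for x
  proof
    fix t
    have \<sigma>_eq: "\<sigma> = (\<lambda>a t. gen_id a t + ?E 0 \<nu> (\<sigma> a) t)" by (rule ext) (rule \<sigma>(3))
    have "S x t = ?E 0 (\<lambda>a t. gen_id a t + ?E 0 \<nu> (\<sigma> a) t) x t"
      unfolding S_def by (rule fun_cong [OF arg_cong [OF \<sigma>_eq, of "\<lambda>s. ?E 0 s x"]])
    also have "\<dots> = ?E 0 gen_id x t + ?E 0 (\<lambda>a. ?E 0 \<nu> (\<sigma> a)) x t"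
      by (simp add: bimod_ext_add_right)
    also have "?E 0 gen_id x t = x t"
      by (cases t) (simp add: bimod_ext_gen_id x)
    also have "?E 0 (\<lambda>a. ?E 0 \<nu> (\<sigma> a)) x = N (S x)"
      unfolding N_def S_def by (simp add: bimod_ext_comp x \<sigma>(1))
    finally show "S x t = x t + N (S x) t" .
  qed
  \<comment> \<open>Both composites solve \<open>X = D + N X\<close>, so their difference is fixed
    by \<open>N\<close> and vanishes.\<close>
  have SD: "S (?D x) = ?D (S x)" if x: "adm_BM x" for x
  proof -
    let ?y = "\<lambda>t. S (?D x) t - ?D (S x) t"
    have "?D (S x) = ?D (\<lambda>t. x t + N (S x) t)" using S [OF x] by simp
    also have "\<dots> = (\<lambda>t. ?D x t + N (?D (S x)) t)"
      by (simp add: DMext_add x N_adm S_adm ND)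
    finally have "?D (S x) = (\<lambda>t. ?D x t + N (?D (S x)) t)" .
    note DS = fun_cong [OF this]
    have "?y = (\<lambda>t. N (S (?D x)) t - N (?D (S x)) t)"
    proof
      fix t show "?y t = N (S (?D x)) t - N (?D (S x)) t"
        using DS [of t] fun_cong [OF S [OF D_adm [OF x]], of t] by simp
    qed
    also have "\<dots> = N ?y"
      unfolding N_def by (rule bimod_ext_diff [symmetric]) (intro S_adm D_adm x)+
    finally have "?E 0 \<nu> ?y = ?y" unfolding N_def by (rule sym)
    then have "?y = (\<lambda>_. 0)" 
      by (rule bimod_map_fixpoint_zero [where \<nu> = \<nu>, rotated]) (rule \<nu>_00)
    then have "?y t = 0" for t by (rule fun_cong)
    then show ?thesis by (intro ext) simp
  qed
  define \<eta> where "\<eta> a = H0 (\<sigma> a)" for a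
  have H: "?E 1 \<eta> x = H0 (S x)" if "adm_BM x" for x
    unfolding \<eta>_def H0_def S_def using that by (simp add: bimod_ext_comp \<sigma>(1))
  show thesis
  proof
    show "adm_BM (\<eta> a)" for a unfolding \<eta>_def by (intro H0_adm \<sigma>)
    have "homog (tdeg degc deg) (deg a + - 1) (\<eta> a)" for a
      unfolding \<eta>_def H0_def by (rule homog_bimod_ext [OF \<sigma>(2)]) (simp add: h')
    then show "homog (tdeg degc deg) (deg a - 1) (\<eta> a)" for a by simp
    fix x :: "'c list \<times> 'm \<times> 'c list \<Rightarrow> 'k" and t
    assume x: "adm_BM x"
    \<comment> \<open>Since \<open>S\<close> commutes with \<open>D\<close>, the sum is
      \<open>(D H0 + H0 D) S = (1 - N) S\<close>.\<close>
    have "?D (?E 1 \<eta> x) t + ?E 1 \<eta> (?D x) t = ?D (H0 (S x)) t + H0 (?D (S x)) t"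
      by (simp add: H x D_adm SD)
    also have "\<dots> = S x t - N (S x) t" by (rule N [OF S_adm [OF x]])
    also have "\<dots> = x t" using fun_cong [OF S [OF x], of t] by simp
    finally show "?D (?E 1 \<eta> x) t + ?E 1 \<eta> (?D x) t = x t" .
  qed
qed

section \<open>The mapping cone\<close>

text \<open>Lowering the degrees of \<open>M\<close> by one turns \<open>f\<close>, of degree 0,
  into a component of degree +1, as a differential demands.\<close>

definition cone_deg :: "('m \<Rightarrow> int) \<Rightarrow> ('n \<Rightarrow> int) \<Rightarrow> 'm + 'n \<Rightarrow> int" where
  "cone_deg degm degn = case_sum (\<lambda>m. degm m - 1) degn"

text \<open>The sign is the Koszul sign for moving the shift of \<open>M\<close> past the left word.\<close>
definition cone_pack :: "('c \<Rightarrow> int) \<Rightarrow> ('c list \<times> 'm \<times> 'c list \<Rightarrow> 'k::field)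
    \<Rightarrow> ('c list \<times> 'n \<times> 'c list \<Rightarrow> 'k) \<Rightarrow> 'c list \<times> ('m + 'n) \<times> 'c list \<Rightarrow> 'k" where
  "cone_pack degc x y = (\<lambda>(u, k, v).
     case k of Inl m \<Rightarrow> ksign (wdeg degc u) * x (u, m, v) | Inr n \<Rightarrow> y (u, n, v))"

text \<open>The cone differential on generators; the minus sign on \<open>dM\<close> is that of the
  shifted cobimodule, and nothing leads from \<open>N\<close> back to \<open>M\<close>.\<close>

definition cone_gen :: "('c \<Rightarrow> int) \<Rightarrow> ('m \<Rightarrow> 'c list \<times> 'm \<times> 'c list \<Rightarrow> 'k::field)
    \<Rightarrow> ('n \<Rightarrow> 'c list \<times> 'n \<times> 'c list \<Rightarrow> 'k) \<Rightarrow> ('m \<Rightarrow> 'c list \<times> 'n \<times> 'c list \<Rightarrow> 'k)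
    \<Rightarrow> 'm + 'n \<Rightarrow> 'c list \<times> ('m + 'n) \<times> 'c list \<Rightarrow> 'k" where
  "cone_gen degc dM dN f k = (case k of Inl m \<Rightarrow> cone_pack degc (\<lambda>t. - dM m t) (f m)
     | Inr n \<Rightarrow> cone_pack degc (\<lambda>_. 0) (dN n))"

lemma cone_pack_apply [simp]:
  "cone_pack degc x y (u, Inl m, v) = ksign (wdeg degc u) * x (u, m, v)"
  "cone_pack degc x y (u, Inr n, v) = y (u, n, v)"
  by (simp_all add: cone_pack_def)

lemma cone_gen_simps [simp]:
  "cone_gen degc dM dN f (Inl m) = cone_pack degc (\<lambda>t. - dM m t) (f m)"
  "cone_gen degc dM dN f (Inr n) = cone_pack degc (\<lambda>_. 0) (dN n)"
  by (simp_all add: cone_gen_def)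

lemma cone_deg_simps [simp]:
  "cone_deg degm degn (Inl m) = degm m - 1" "cone_deg degm degn (Inr n) = degn n"
  by (simp_all add: cone_deg_def)

lemma cone_ext:
  fixes z z' :: "'c list \<times> ('m + 'n) \<times> 'c list \<Rightarrow> 'k"
  assumes "\<And>u m v. z (u, Inl m, v) = z' (u, Inl m, v)" "\<And>u n v. z (u, Inr n, v) = z' (u, Inr n, v)"
  shows "z = z'"
proof
  fix t show "z t = z' t"
    using assms by (cases t; cases "fst (snd t)") auto
qed

lemma cone_pack_eqD:
  assumes "cone_pack degc x y = cone_pack degc x' y'"
  shows "x = x'" "y = y'"
proof -
  have "x (u, m, v) = x' (u, m, v)" for u m v
    using fun_cong [OF assms, of "(u, Inl m, v)"] by simp
  then show "x = x'" by (intro ext) auto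
  have "y (u, n, v) = y' (u, n, v)" for u n v
    using fun_cong [OF assms, of "(u, Inr n, v)"] by simp
  then show "y = y'" by (intro ext) auto
qed

lemma cone_pack_zero [simp]: "cone_pack degc (\<lambda>_. 0) (\<lambda>_. 0) = (\<lambda>_. 0)"
  by (rule cone_ext) simp_all

lemma cone_pack_add:
  "cone_pack degc x y t + cone_pack degc x' y' t = cone_pack degc (\<lambda>t. x t + x' t) (\<lambda>t. y t + y' t) t"
  by (cases t; cases "fst (snd t)") (auto simp: distrib_left)

lemma adm_BM_cone_pack:
  assumes "adm_BM x" "adm_BM y"
  shows "adm_BM (cone_pack degc x y)"
proof (rule adm_BM_subsetI, intro exI conjI allI impI)
  fix i j
  let ?X = "{(u, m, v). length u = i \<and> length v = j \<and> x (u, m, v) \<noteq> 0}"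
  let ?Y = "{(u, n, v). length u = i \<and> length v = j \<and> y (u, n, v) \<noteq> 0}"
  let ?A = "(\<lambda>(u, m, v). (u, Inl m, v)) ` ?X \<union> (\<lambda>(u, n, v). (u, Inr n, v)) ` ?Y"
  show "finite ?A"
    using assms by (intro finite_UnI finite_imageI adm_BM_finite)
  fix u k v
  assume len: "length u = i" "length v = j" and nz: "cone_pack degc x y (u, k, v) \<noteq> 0"
  show "(u, k, v) \<in> ?A"
  proof (cases k)
    case (Inl m)
    then have "(u, k, v) \<in> (\<lambda>(u, m, v). (u, Inl m, v)) ` ?X"
      using len nz by (intro image_eqI [of _ _ "(u, m, v)"]) auto
    then show ?thesis ..
  next
    case (Inr n)
    then have "(u, k, v) \<in> (\<lambda>(u, n, v). (u, Inr n, v)) ` ?Y"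
      using len nz by (intro image_eqI [of _ _ "(u, n, v)"]) auto
    then show ?thesis ..
  qed
qed

text \<open>The packing sign is its own inverse. The degree statement is an implication, so that the
  components are chosen before any grading is fixed.\<close>

lemma cone_unpack:
  assumes "adm_BM z"
  obtains x y where "adm_BM x" "adm_BM y" "z = cone_pack degc x y"
    "\<And>deg degn k. homog (tdeg degc (cone_deg deg degn)) k z
      \<Longrightarrow> homog (tdeg degc deg) (k + 1) x \<and> homog (tdeg degc degn) k y"
proof
  define x where "x = (\<lambda>(u, m, v). ksign (wdeg degc u) * z (u, Inl m, v))"
  define y where "y = (\<lambda>(u, n, v). z (u, Inr n, v))"
  have 1: "x (u, m, v) \<noteq> 0 \<longleftrightarrow> z (u, Inl m, v) \<noteq> 0" for u m v
    by (simp add: x_def)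
  show "adm_BM x"
  proof (rule adm_BM_subsetI, intro exI conjI allI impI)
    fix i j
    let ?Z = "{(u, k, v). length u = i \<and> length v = j \<and> z (u, k, v) \<noteq> 0}"
    show "finite ((\<lambda>(u, k, v). (u, projl k, v)) ` ?Z)"
      using assms by (intro finite_imageI adm_BM_finite)
    fix u m v assume "length u = i" "length v = j" "x (u, m, v) \<noteq> 0"
    then show "(u, m, v) \<in> (\<lambda>(u, k, v). (u, projl k, v)) ` ?Z"
      by (intro image_eqI [of _ _ "(u, Inl m, v)"]) (auto simp: 1)
  qed
  show "adm_BM y"
  proof (rule adm_BM_subsetI, intro exI conjI allI impI)
    fix i j
    let ?Z = "{(u, k, v). length u = i \<and> length v = j \<and> z (u, k, v) \<noteq> 0}"
    show "finite ((\<lambda>(u, k, v). (u, projr k, v)) ` ?Z)"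
      using assms by (intro finite_imageI adm_BM_finite)
    fix u n v assume "length u = i" "length v = j" "y (u, n, v) \<noteq> 0"
    then show "(u, n, v) \<in> (\<lambda>(u, k, v). (u, projr k, v)) ` ?Z"
      by (intro image_eqI [of _ _ "(u, Inr n, v)"]) (auto simp: y_def)
  qed
  show "z = cone_pack degc x y"
    by (rule cone_ext) (simp_all add: x_def y_def flip: mult.assoc)
  fix deg degn k assume z: "homog (tdeg degc (cone_deg deg degn)) k z"
  have "tdeg degc deg (u, m, v) = k + 1" if "x (u, m, v) \<noteq> 0" for u m v
  proof -
    have "z (u, Inl m, v) \<noteq> 0" using that by (simp add: x_def)
    then have "tdeg degc (cone_deg deg degn) (u, Inl m, v) = k" using z by (simp add: homog_def)
    then show ?thesis by (simp add: tdeg_def)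
  qed
  moreover have "tdeg degc degn (u, n, v) = k" if "y (u, n, v) \<noteq> 0" for u n v
  proof -
    have "z (u, Inr n, v) \<noteq> 0" using that by (simp add: y_def)
    then have "tdeg degc (cone_deg deg degn) (u, Inr n, v) = k" using z by (simp add: homog_def)
    then show ?thesis by (simp add: tdeg_def)
  qed
  ultimately show "homog (tdeg degc deg) (k + 1) x \<and> homog (tdeg degc degn) k y"
    by (auto simp: homog_def)
qed

lemma homog_cone_pack:
  assumes "homog (tdeg degc degm) (k + 1) x" "homog (tdeg degc degn) k y"
  shows "homog (tdeg degc (cone_deg degm degn)) k (cone_pack degc x y)"
  unfolding homog_def
proof (intro allI impI)
  fix t assume nz: "cone_pack degc x y t \<noteq> 0"
  obtain u a v where t: "t = (u, a, v)" by (cases t)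
  show "tdeg degc (cone_deg degm degn) t = k"
  proof (cases a)
    case (Inl m)
    then have "tdeg degc degm (u, m, v) = k + 1" using assms nz by (auto simp: t homog_def)
    then show ?thesis by (simp add: t Inl tdeg_def)
  next
    case (Inr n)
    then have "tdeg degc degn (u, n, v) = k" using assms nz by (auto simp: t homog_def)
    then show ?thesis by (simp add: t Inr tdeg_def)
  qed
qed

lemma pairing_Plus:
  assumes "fin_supp z"
  shows "pairing z k = pairing (\<lambda>m. z (Inl m)) (\<lambda>m. k (Inl m)) + pairing (\<lambda>n. z (Inr n)) (\<lambda>n. k (Inr n))"
proof -
  let ?A = "{m. z (Inl m) \<noteq> 0}" and ?B = "{n. z (Inr n) \<noteq> 0}"
  have eq: "{a. z a \<noteq> 0} = Inl ` ?A \<union> Inr ` ?B"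
  proof (rule set_eqI)
    fix a show "a \<in> {a. z a \<noteq> 0} \<longleftrightarrow> a \<in> Inl ` ?A \<union> Inr ` ?B" by (cases a) auto
  qed
  have "finite (Inl ` ?A \<union> Inr ` ?B)" using assms unfolding fin_supp_def eq .
  then have "pairing z k = (\<Sum>a\<in>Inl ` ?A. z a * k a) + (\<Sum>a\<in>Inr ` ?B. z a * k a)"
    unfolding pairing_def eq by (intro sum.union_disjoint) auto
  then show ?thesis by (simp add: pairing_def sum.reindex)
qed

text \<open>The packing sign reconciles the odd extension on the cone with the even map
  \<open>F\<close>. From \<open>M\<close> to \<open>N\<close> both signs are
  \<open>ksign (wdeg degc u)\<close> and cancel. From \<open>M\<close> to \<open>M\<close> packing
  \<open>dM\<close> adds the sign of \<open>p\<close>, and the product is the sign of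
  \<open>u'\<close> times that of the odd extension of \<open>dM\<close>.\<close>

lemma bimod_ext_cone:
  fixes x :: "'c list \<times> 'm \<times> 'c list \<Rightarrow> 'k::field"
  assumes x: "adm_BM x" and y: "adm_BM y"
  shows "bimod_ext degc 1 (cone_gen degc dM dN f) (cone_pack degc x y)
     = cone_pack degc (\<lambda>t. - bimod_ext degc 1 dM x t) (\<lambda>t. Fext f x t + bimod_ext degc 1 dN y t)"
proof (rule cone_ext)
  fix u' v' m'
  note pp = pairing_Plus [OF fin_supp_slice [OF adm_BM_cone_pack [OF x y]]]
  have "ksign (wdeg degc u) * pairing (\<lambda>k. cone_pack degc x y (u, k, z)) (\<lambda>k. cone_gen degc dM dN f k (p, Inl m', q))
      = - (ksign (wdeg degc u') * (ksign (wdeg degc u) * pairing (\<lambda>m. x (u, m, z)) (\<lambda>m. dM m (p, m', q))))"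
    if "(u, p) \<in> splits u'" for u p q z
  proof -
    have "ksign (wdeg degc u') = (ksign (wdeg degc u) * ksign (wdeg degc p) :: 'k)"
      using that by (auto simp: splits_def ksign_add)
    then show ?thesis
      by (simp add: pp pairing_cmult_left pairing_cmult_right pairing_uminus_right flip: mult.assoc)
  qed
  then show "bimod_ext degc 1 (cone_gen degc dM dN f) (cone_pack degc x y) (u', Inl m', v')
     = cone_pack degc (\<lambda>t. - bimod_ext degc 1 dM x t) (\<lambda>t. Fext f x t + bimod_ext degc 1 dN y t) (u', Inl m', v')"
    by (auto simp: bimod_ext_apply sum_distrib_left simp flip: sum_negf intro!: sum.cong)
next
  fix u' v' n'
  note pp = pairing_Plus [OF fin_supp_slice [OF adm_BM_cone_pack [OF x y]]]
  have "ksign (wdeg degc u) * pairing (\<lambda>k. cone_pack degc x y (u, k, z)) (\<lambda>k. cone_gen degc dM dN f k (p, Inr n', q))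
      = pairing (\<lambda>m. x (u, m, z)) (\<lambda>m. f m (p, n', q))
       + ksign (wdeg degc u) * pairing (\<lambda>n. y (u, n, z)) (\<lambda>n. dN n (p, n', q))" for u p q z
    by (simp add: pp pairing_cmult_left distrib_left flip: mult.assoc)
  then show "bimod_ext degc 1 (cone_gen degc dM dN f) (cone_pack degc x y) (u', Inr n', v')
     = cone_pack degc (\<lambda>t. - bimod_ext degc 1 dM x t) (\<lambda>t. Fext f x t + bimod_ext degc 1 dN y t) (u', Inr n', v')"
    by (simp add: Fext_eq [of _ degc] bimod_ext_apply sum.distrib case_prod_beta)
qed

context graded_cogenerators
begin

text \<open>\<open>d\<close> changes the degree of the left word by one and hence the packing sign,
  which gives the minus sign on the \<open>M\<close> part.\<close>

lemma diff_left_cone: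
  "diff_left degc d (cone_pack degc x y) = cone_pack degc (\<lambda>t. - diff_left degc d x t) (diff_left degc d y)"
proof (rule cone_ext)
  fix u' v' m
  have "ksign (wdeg degc u) * pairing (\<lambda>c. cone_pack degc x y (u @ [c] @ z, Inl m, v')) (\<lambda>c. d c v)
     = - (ksign (wdeg degc u') * (ksign (wdeg degc u) * pairing (\<lambda>c. x (u @ [c] @ z, m, v')) (\<lambda>c. d c v)))"
    if "(u, v, z) \<in> splits3 u'" for u v z
  proof -
    have u': "u' = u @ v @ z" using that by (simp add: splits3_def)
    have "pairing (\<lambda>c. cone_pack degc x y (u @ [c] @ z, Inl m, v')) (\<lambda>c. d c v)
       = pairing (\<lambda>c. x (u @ [c] @ z, m, v')) (\<lambda>c. ksign (wdeg degc (u @ [c] @ z)) * d c v)"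
      unfolding cone_pack_apply by (simp add: pairing_def mult_ac)
    also have "(\<lambda>c. ksign (wdeg degc (u @ [c] @ z)) * d c v) = (\<lambda>c. - ksign (wdeg degc u') * d c v)"
    proof
      fix c show "ksign (wdeg degc (u @ [c] @ z)) * d c v = - ksign (wdeg degc u') * d c v"
        by (cases "d c v = 0") (simp_all only: u' ksign_wdeg_d mult_zero_right)
    qed
    finally show ?thesis unfolding pairing_cmult_right by simp
  qed
  then show "diff_left degc d (cone_pack degc x y) (u', Inl m, v')
     = cone_pack degc (\<lambda>t. - diff_left degc d x t) (diff_left degc d y) (u', Inl m, v')"
    by (auto simp: diff_left_apply sum_distrib_left simp flip: sum_negf intro!: sum.cong)
qed (simp add: diff_left_apply)

text \<open>The packing sign is unaffected; the minus sign comes from the shifted degree of the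
  generator.\<close>

lemma diff_right_cone:
  "diff_right degc (cone_deg degm degn) d (cone_pack degc x y)
     = cone_pack degc (\<lambda>t. - diff_right degc degm d x t) (diff_right degc degn d y)"
proof (rule cone_ext)
  fix u' v' m
  have "ksign (wdeg degc u' + cone_deg degm degn (Inl m) + wdeg degc u) = (- ksign (wdeg degc u' + degm m + wdeg degc u) :: 'k)" for u
    by (simp add: ksign_add)
  then show "diff_right degc (cone_deg degm degn) d (cone_pack degc x y) (u', Inl m, v')
     = cone_pack degc (\<lambda>t. - diff_right degc degm d x t) (diff_right degc degn d y) (u', Inl m, v')"
    unfolding diff_right_apply cone_pack_apply pairing_cmult_left
    by (simp add: sum_distrib_left case_prod_beta mult_ac sum_negf)
qed (simp add: diff_right_apply)

lemma DMext_cone: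
  assumes "adm_BM x" "adm_BM y"
  shows "DMext degc (cone_deg degm degn) d (cone_gen degc dM dN f) (cone_pack degc x y)
     = cone_pack degc (\<lambda>t. - DMext degc degm d dM x t) (\<lambda>t. Fext f x t + DMext degc degn d dN y t)"
  by (rule cone_ext)
    (simp_all add: DMext_eq bimod_ext_cone assms diff_left_cone diff_right_cone algebra_simps)

text \<open>The square of the cone differential consists of \<open>D^M D^M\<close>,
  \<open>D^N D^N\<close> and the commutator \<open>D^N F - F D^M\<close>, all of which
  vanish.\<close>

lemma ainf_cobimod_cone:
  fixes degm :: "'m \<Rightarrow> int" and degn :: "'n \<Rightarrow> int"
  assumes M: "ainf_cobimod degc degm d dM" and N: "ainf_cobimod degc degn d dN"
    and f: "cobimod_map degc degm degn d dM dN f"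
  shows "ainf_cobimod degc (cone_deg degm degn) d (cone_gen degc dM dN f)"
  unfolding ainf_cobimod_def
proof (intro conjI allI impI)
  let ?DM = "DMext degc degm d dM" and ?DN = "DMext degc degn d dN"
  have dM: "adm_BM (dM m)" "homog (tdeg degc degm) (degm m + 1) (dM m)" for m
    using M by (auto simp: ainf_cobimod_def)
  have dN: "adm_BM (dN n)" "homog (tdeg degc degn) (degn n + 1) (dN n)" for n
    using N by (auto simp: ainf_cobimod_def)
  have f': "adm_BM (f m)" "homog (tdeg degc degn) (degm m) (f m)" for m
    using f by (auto simp: cobimod_map_def)
  fix k
  show "adm_BM (cone_gen degc dM dN f k)"
    by (cases k) (auto intro!: adm_BM_cone_pack adm_BM_uminus dM dN f')
  show "homog (tdeg degc (cone_deg degm degn)) (cone_deg degm degn k + 1) (cone_gen degc dM dN f k)"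
    by (cases k) (auto intro!: homog_cone_pack homog_uminus dM dN f')
  fix z :: "'c list \<times> ('m + 'n) \<times> 'c list \<Rightarrow> 'k" assume adm_z: "adm_BM z"
  obtain x y where x: "adm_BM x" and y: "adm_BM y" and z: "z = cone_pack degc x y"
    by (rule cone_unpack [OF adm_z]) (rule that)
  have 1: "?DM (?DM x) = (\<lambda>_. 0)" and 2: "?DN (?DN y) = (\<lambda>_. 0)" and 3: "?DN (Fext f x) = Fext f (?DM x)"
    using M N f x y by (auto simp: ainf_cobimod_def cobimod_map_def)
  have adm: "adm_BM (?DM x)" "adm_BM (?DN y)" "adm_BM (Fext f x)"
    using x y unfolding Fext_eq [of f degc]
    by (auto intro!: adm_BM_DMext adm_BM_bimod_ext dM dN f')
  show "DMext degc (cone_deg degm degn) d (cone_gen degc dM dN f)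
      (DMext degc (cone_deg degm degn) d (cone_gen degc dM dN f) z) = (\<lambda>_. 0)"
    unfolding z
    by (simp add: DMext_cone x y adm adm_BM_uminus adm_BM_add DMext_uminus DMext_add 1 2 3)
      (simp add: Fext_eq [of f degc] bimod_ext_uminus)
qed

section \<open>Lowest components and acyclicity of the cone\<close>

lemma comp00_chain_map:
  fixes x :: "'m \<Rightarrow> 'k"
  assumes f: "cobimod_map degc degm degn d dM dN f" and x: "fin_supp x"
  shows "comp00 dN (comp00 f x) = comp00 f (comp00 dM x)"
proof
  fix n
  \<comment> \<open>\<open>x\<close> is placed on empty words, with the unit type as a dummy set of
    generators; the extended identity is then read off at empty words.\<close>
  let ?z = "gen_diag (\<lambda>_. x) () :: 'c list \<times> 'm \<times> 'c list \<Rightarrow> 'k"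
  have z: "adm_BM ?z" "(\<lambda>m. ?z ([], m, [])) = x"
    using x by (auto simp: gen_diag_apply intro: adm_BM_gen_diag)
  have "DMext degc degn d dN (Fext f ?z) ([], n, []) = Fext f (DMext degc degm d dM ?z) ([], n, [])"
    using f z(1) by (simp add: cobimod_map_def)
  then show "comp00 dN (comp00 f x) n = comp00 f (comp00 dM x) n"
    unfolding Fext_eq [of f degc] DMext_00 bimod_ext_00 z(2) .
qed

lemma comp00_square_zero:
  fixes x :: "'m \<Rightarrow> 'k"
  assumes M: "ainf_cobimod degc degm d dM" and x: "fin_supp x"
  shows "comp00 dM (comp00 dM x) = (\<lambda>_. 0)"
proof
  fix m
  let ?z = "gen_diag (\<lambda>_. x) () :: 'c list \<times> 'm \<times> 'c list \<Rightarrow> 'k"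
  have z: "adm_BM ?z" "(\<lambda>m. ?z ([], m, [])) = x"
    using x by (auto simp: gen_diag_apply intro: adm_BM_gen_diag)
  have "DMext degc degm d dM (DMext degc degm d dM ?z) ([], m, []) = 0"
    using M z(1) by (simp add: ainf_cobimod_def)
  then show "comp00 dM (comp00 dM x) m = 0"
    unfolding DMext_00 z(2) .
qed

end

lemma comp00_cone:
  assumes "fin_supp x"
  shows "comp00 (cone_gen degc dM dN f) x (Inl m) = - comp00 dM (\<lambda>m. x (Inl m)) m"
    "comp00 (cone_gen degc dM dN f) x (Inr n) = comp00 f (\<lambda>m. x (Inl m)) n + comp00 dN (\<lambda>n. x (Inr n)) n"
  by (simp_all add: comp00_eq pairing_Plus [OF assms] pairing_uminus_right)

lemma comp00_diff:
  assumes "fin_supp x" "fin_supp y"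
  shows "comp00 \<phi> (\<lambda>m. x m - y m) = (\<lambda>n. comp00 \<phi> x n - comp00 \<phi> y n)"
  using pairing_add_left [OF assms(1) fin_supp_uminus [OF assms(2)]]
  by (simp add: comp00_eq pairing_uminus_left)

lemma fin_supp_Inl: "fin_supp x \<Longrightarrow> fin_supp (\<lambda>m. x (Inl m))"
  unfolding fin_supp_def by (drule finite_vimageI [of _ Inl]) (simp_all add: vimage_def)

lemma fin_supp_Inr: "fin_supp x \<Longrightarrow> fin_supp (\<lambda>n. x (Inr n))"
  unfolding fin_supp_def by (drule finite_vimageI [of _ Inr]) (simp_all add: vimage_def)

lemma fin_supp_case_sum:
  assumes "fin_supp x" "fin_supp y" shows "fin_supp (case_sum x y)"
  unfolding fin_supp_def
proof (rule finite_subset)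
  show "{a. case_sum x y a \<noteq> 0} \<subseteq> Inl ` {m. x m \<noteq> 0} \<union> Inr ` {n. y n \<noteq> 0}"
  proof
    fix a assume "a \<in> {a. case_sum x y a \<noteq> 0}"
    then show "a \<in> Inl ` {m. x m \<noteq> 0} \<union> Inr ` {n. y n \<noteq> 0}" by (cases a) auto
  qed
  show "finite (Inl ` {m. x m \<noteq> 0} \<union> Inr ` {n. y n \<noteq> 0})"
    using assms by (simp add: fin_supp_def)
qed

text \<open>A diagram chase: injectivity on homology bounds the \<open>M\<close> part, and
  surjectivity corrects the remaining \<open>N\<close> part.\<close>

lemma (in graded_cogenerators) cone_acyclic:
  assumes M: "ainf_cobimod degc degm d dM" and N: "ainf_cobimod degc degn d dN"
    and f: "cobimod_map degc degm degn d dM dN f"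
    and iso: "induces_hom_iso fin_supp degm (comp00 dM) fin_supp degn (comp00 dN) (comp00 f)"
    and x: "x \<in> cycles fin_supp (cone_deg degm degn) (comp00 (cone_gen degc dM dN f)) k"
  shows "x \<in> bdries fin_supp (cone_deg degm degn) (comp00 (cone_gen degc dM dN f)) k"
proof -
  define xM where "xM = (\<lambda>m. x (Inl m))"
  define xN where "xN = (\<lambda>n. x (Inr n))"
  have x_fin: "fin_supp x" and x_hom: "homog (cone_deg degm degn) k x"
    and x_cyc: "comp00 (cone_gen degc dM dN f) x = (\<lambda>_. 0)"
    using x by (auto simp: cycles_def)
  have fin: "fin_supp xM" "fin_supp xN"
    using x_fin unfolding xM_def xN_def by (auto intro: fin_supp_Inl fin_supp_Inr)
  have hom: "homog degm (k + 1) xM" "homog degn k xN"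
    using x_hom unfolding homog_def xM_def xN_def by (force, force)
  have f_fin: "fin_supp (comp00 f y)" if "fin_supp y" for y
    unfolding comp00_eq using f that
    by (intro fin_supp_pairing) (auto simp: cobimod_map_def intro: fin_supp_slice)
  have f_hom: "homog degn l (comp00 f y)" if "homog degm l y" for l y
  proof -
    have "homog (tdeg degc degn) (degm m) (f m)" for m
      using f by (simp add: cobimod_map_def)
    then have "homog degn (degm m + 0) (\<lambda>n. f m ([], n, []))" for m
      by (fastforce simp: homog_def tdeg_def)
    from homog_pairing [OF that this] show ?thesis by (simp add: comp00_eq)
  qed
  have dM0: "comp00 dM xM = (\<lambda>_. 0)"
  proof
    show "comp00 dM xM m = 0" for m
      using fun_cong [OF x_cyc, of "Inl m"] by (simp add: comp00_cone x_fin xM_def)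
  qed
  have fdN: "comp00 f xM n + comp00 dN xN n = 0" for n
    using fun_cong [OF x_cyc, of "Inr n"] by (simp add: comp00_cone x_fin xM_def xN_def)
  have dN_uminus: "comp00 dN (\<lambda>n. - y n) n = - comp00 dN y n" for y n
    by (simp add: comp00_eq pairing_uminus_left)
  have "xM \<in> cycles fin_supp degm (comp00 dM) (k + 1)"
    by (simp add: cycles_def fin hom dM0)
  \<comment> \<open>The \<open>N\<close> component of the cycle condition exhibits
    \<open>- xN\<close> as a primitive of the image of \<open>xM\<close>.\<close>
  moreover have "comp00 f xM \<in> bdries fin_supp degn (comp00 dN) (k + 1)"
    unfolding bdries_def
    by (rule CollectI, rule exI [of _ "\<lambda>n. - xN n"])
      (use fdN in \<open>auto simp: fin_supp_uminus homog_uminus fin hom dN_uminus eq_neg_iff_add_eq_0\<close>)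
  ultimately have "xM \<in> bdries fin_supp degm (comp00 dM) (k + 1)"
    using iso by (simp add: induces_hom_iso_def)
  then obtain x1 where x1: "xM = comp00 dM x1" "fin_supp x1" "homog degm k x1"
    by (auto simp: bdries_def)
  \<comment> \<open>Once \<open>x1\<close> bounds \<open>xM\<close>, the defect left in
    \<open>N\<close> is a cycle but perhaps no boundary; surjectivity supplies a cycle
    \<open>x2\<close> of \<open>M\<close> in its class.\<close>
  define w where "w n = comp00 f x1 n + xN n" for n
  have "comp00 dN w = (\<lambda>_. 0)"
  proof
    fix n
    have "comp00 dN w n = comp00 dN (comp00 f x1) n + comp00 dN xN n"
      unfolding w_def comp00_eq [of dN] by (intro pairing_add_left f_fin x1 fin)
    also have "\<dots> = 0" by (simp add: comp00_chain_map [OF f x1(2)] flip: x1(1)) (rule fdN)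
    finally show "comp00 dN w n = 0" .
  qed
  moreover have "fin_supp w" "homog degn k w"
    unfolding w_def by (intro fin_supp_add homog_add f_fin f_hom x1 fin hom)+
  ultimately have "w \<in> cycles fin_supp degn (comp00 dN) k" by (simp add: cycles_def)
  then obtain x2 where x2: "x2 \<in> cycles fin_supp degm (comp00 dM) k"
    and "(\<lambda>n. comp00 f x2 n - w n) \<in> bdries fin_supp degn (comp00 dN) k"
    using iso unfolding induces_hom_iso_def by blast
  then obtain y where y: "(\<lambda>n. comp00 f x2 n - w n) = comp00 dN y" "fin_supp y" "homog degn (k - 1) y"
    by (auto simp: bdries_def)
  have x2': "fin_supp x2" "homog degm k x2" "comp00 dM x2 = (\<lambda>_. 0)"
    using x2 by (auto simp: cycles_def)
  \<comment> \<open>The cycle \<open>x2\<close> does not disturb the \<open>M\<close> component,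
    where \<open>- x1\<close> already gives \<open>xM\<close>. The \<open>N\<close> component
    becomes \<open>f x2 - f x1 - (f x2 - w) = xN\<close>.\<close>
  define z where "z = case_sum (\<lambda>m. x2 m - x1 m) (\<lambda>n. - y n)"
  have z_fin: "fin_supp z"
    unfolding z_def by (intro fin_supp_case_sum fin_supp_diff fin_supp_uminus x1 x2' y)
  have "homog degm k (\<lambda>m. x2 m - x1 m)" by (intro homog_diff x1 x2')
  then have z_hom: "homog (cone_deg degm degn) (k - 1) z"
    using y(3) by (auto simp: z_def homog_def split: sum.splits)
  note diff = comp00_diff [OF x2'(1) x1(2)]
  have "comp00 (cone_gen degc dM dN f) z = x"
  proof
    fix a show "comp00 (cone_gen degc dM dN f) z a = x a"
    proof (cases a)
      case (Inl m)
      then show ?thesis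
        using fun_cong [OF x1(1), of m] by (simp add: comp00_cone z_fin) (simp add: z_def diff x2' xM_def)
    next
      case (Inr n)
      then show ?thesis
        using fun_cong [OF y(1), of n]
        by (simp add: comp00_cone z_fin) (simp add: z_def diff dN_uminus w_def xN_def algebra_simps)
    qed
  qed
  then show ?thesis unfolding bdries_def using z_fin z_hom by blast
qed

text \<open>Packing again absorbs the sign of the odd extension: the component from \<open>N\<close>
  to \<open>M\<close> extends without signs, as a map of degree 0 must.\<close>

lemma bimod_ext_cone_Inr:
  fixes y :: "'c list \<times> 'n \<times> 'c list \<Rightarrow> 'k::field"
  assumes y: "adm_BM y" and \<eta>: "\<And>n. \<eta> (Inr n) = cone_pack degc (g n) (c n)"
  shows "bimod_ext degc 1 \<eta> (cone_pack degc (\<lambda>_. 0) y) = cone_pack degc (Fext g y) (bimod_ext degc 1 c y)"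
proof (rule cone_ext)
  fix u' v' m'
  note pp = pairing_Plus [OF fin_supp_slice [OF adm_BM_cone_pack [OF adm_BM_zero y]]]
  have "ksign (wdeg degc u) * pairing (\<lambda>k. cone_pack degc (\<lambda>_. 0) y (u, k, z)) (\<lambda>k. \<eta> k (p, Inl m', q))
      = ksign (wdeg degc u') * pairing (\<lambda>n. y (u, n, z)) (\<lambda>n. g n (p, m', q))"
    if "(u, p) \<in> splits u'" for u p q z
    using that by (auto simp: splits_def ksign_add pp \<eta> pairing_cmult_right)
  then show "bimod_ext degc 1 \<eta> (cone_pack degc (\<lambda>_. 0) y) (u', Inl m', v')
      = cone_pack degc (Fext g y) (bimod_ext degc 1 c y) (u', Inl m', v')"
    by (auto simp: Fext_eq [of g degc] bimod_ext_apply sum_distrib_left intro!: sum.cong)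
next
  fix u' v' n'
  note pp = pairing_Plus [OF fin_supp_slice [OF adm_BM_cone_pack [OF adm_BM_zero y]]]
  show "bimod_ext degc 1 \<eta> (cone_pack degc (\<lambda>_. 0) y) (u', Inr n', v')
      = cone_pack degc (Fext g y) (bimod_ext degc 1 c y) (u', Inr n', v')"
    by (simp add: bimod_ext_apply pp \<eta>)
qed

section \<open>The quasi-inverse and the two homotopies\<close>

theorem mainTheorem2:
  fixes degc :: "'c \<Rightarrow> int" and degm :: "'m \<Rightarrow> int" and degn :: "'n \<Rightarrow> int"
    and d :: "'c \<Rightarrow> 'c list \<Rightarrow> 'k::field"
    and dM :: "'m \<Rightarrow> ('c list \<times> 'm \<times> 'c list) \<Rightarrow> 'k"
    and dN :: "'n \<Rightarrow> ('c list \<times> 'n \<times> 'c list) \<Rightarrow> 'k"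
    and f :: "'m \<Rightarrow> ('c list \<times> 'n \<times> 'c list) \<Rightarrow> 'k"
  assumes "ainf_coalg degc d"
    and "ainf_cobimod degc degm d dM"
    and "ainf_cobimod degc degn d dN"
    and "cobimod_map degc degm degn d dM dN f"
    and "induces_hom_iso fin_supp degm (comp00 dM) fin_supp degn (comp00 dN) (comp00 f)"
  shows "\<exists>g. cobimod_map degc degn degm d dN dM g \<and>
    hom_comp_id adm_BM (tdeg degc degm) (DMext degc degm d dM) (Fext g) (Fext f) \<and>
    hom_comp_id adm_BM (tdeg degc degn) (DMext degc degn d dN) (Fext f) (Fext g)"
proof -
  interpret graded_cogenerators degc d
    using assms(1) by unfold_locales (auto simp: ainf_coalg_def)
  let ?DM = "DMext degc degm d dM" and ?DN = "DMext degc degn d dN"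
  let ?deg = "cone_deg degm degn" and ?dK = "cone_gen degc dM dN f"
  let ?DK = "DMext degc ?deg d ?dK"
  note K = ainf_cobimod_cone [OF assms(2,3,4)]
  have dM: "\<And>m. adm_BM (dM m)" and dN: "\<And>n. adm_BM (dN n)" and f: "\<And>m. adm_BM (f m)"
    and dK: "\<And>k. adm_BM (?dK k)" "\<And>k. homog (tdeg degc ?deg) (?deg k + 1) (?dK k)"
    using assms(2-4) K by (auto simp: ainf_cobimod_def cobimod_map_def)
  have lin: "comp00 ?dK = lin_ext (\<lambda>a b. ?dK a ([], b, []))"
    by (intro ext) (simp add: comp00_eq lin_ext_def)
  have hom00: "homog ?deg (?deg a + 1) (\<lambda>b. ?dK a ([], b, []))" for a
    using dK(2) [of a] by (fastforce simp: homog_def tdeg_def)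
  obtain h where h: "\<And>a. fin_supp (h a)" "\<And>a. homog ?deg (?deg a - 1) (h a)"
    "\<And>a b. pairing (h a) (\<lambda>c. ?dK c ([], b, [])) + pairing (\<lambda>c. ?dK a ([], c, [])) (\<lambda>c. h c b)
      = (if b = a then 1 else 0)"
    using graded_contraction [of "\<lambda>a b. ?dK a ([], b, [])" ?deg, OF fin_supp_slice [OF dK(1)] hom00
        comp00_square_zero [OF K, unfolded lin] cone_acyclic [OF assms(2-5), unfolded lin]]
    by blast
  obtain \<eta> where \<eta>: "\<And>a. adm_BM (\<eta> a)" "\<And>a. homog (tdeg degc ?deg) (?deg a - 1) (\<eta> a)"
    and contr: "\<And>x t. adm_BM x \<Longrightarrow> ?DK (bimod_ext degc 1 \<eta> x) t + bimod_ext degc 1 \<eta> (?DK x) t = x t"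
    using cobimod_contraction [OF K h] by blast
  \<comment> \<open>On generators of \<open>N\<close> the contraction has a component
    \<open>g\<close> into \<open>M\<close> and a component \<open>c\<close> into \<open>N\<close>.
    By the shift, degree -1 on the cone is degree 0 for \<open>g\<close>.\<close>
  have "\<exists>x y. adm_BM x \<and> adm_BM y \<and> \<eta> (Inr n) = cone_pack degc x y
      \<and> homog (tdeg degc degm) (degn n) x \<and> homog (tdeg degc degn) (degn n - 1) y" for n
  proof -
    obtain x y where "adm_BM x" "adm_BM y" "\<eta> (Inr n) = cone_pack degc x y"
      "homog (tdeg degc ?deg) (degn n - 1) (\<eta> (Inr n))
        \<Longrightarrow> homog (tdeg degc degm) (degn n - 1 + 1) x \<and> homog (tdeg degc degn) (degn n - 1) y"
      using cone_unpack [OF \<eta>(1) [of "Inr n"], of degc] by metis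
    moreover have "homog (tdeg degc ?deg) (degn n - 1) (\<eta> (Inr n))" using \<eta>(2) [of "Inr n"] by simp
    ultimately show ?thesis by auto
  qed
  then obtain g c where g: "\<And>n. adm_BM (g n)" "\<And>n. homog (tdeg degc degm) (degn n) (g n)"
    and c: "\<And>n. adm_BM (c n)" "\<And>n. homog (tdeg degc degn) (degn n - 1) (c n)"
    and \<eta>_Inr: "\<And>n. \<eta> (Inr n) = cone_pack degc (g n) (c n)"
    by metis
  define C where "C = bimod_ext degc 1 c"
  have adm: "\<And>x. adm_BM x \<Longrightarrow> adm_BM (?DM x)" "\<And>y. adm_BM y \<Longrightarrow> adm_BM (?DN y)"
    "\<And>x. adm_BM x \<Longrightarrow> adm_BM (Fext f x)" "\<And>y. adm_BM y \<Longrightarrow> adm_BM (Fext g y)"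
    "\<And>y. adm_BM y \<Longrightarrow> adm_BM (C y)"
    unfolding C_def Fext_eq [of f degc] Fext_eq [of g degc]
    by (intro adm_BM_DMext adm_BM_bimod_ext dM dN f g c; assumption)+
  have F0: "Fext f (\<lambda>_. 0) = (\<lambda>_. 0)" and C0: "C (\<lambda>_. 0) = (\<lambda>_. 0)"
    by (simp_all add: Fext_eq [of f degc] C_def)
  have H_Inr: "bimod_ext degc 1 \<eta> (cone_pack degc (\<lambda>_. 0) y) = cone_pack degc (Fext g y) (C y)"
    if "adm_BM y" for y
    unfolding C_def by (rule bimod_ext_cone_Inr [OF that]) (rule \<eta>_Inr)
  \<comment> \<open>The contraction identity at \<open>(0, y)\<close>. The cone differential keeps
    this pair inside \<open>N\<close>, so the components read \<open>G D^N = D^M G\<close> and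
    \<open>F G + D^N C + C D^N = 1\<close>.\<close>
  have N_eqs: "(\<lambda>t. - ?DM (Fext g y) t + Fext g (?DN y) t) = (\<lambda>_. 0)"
    "(\<lambda>t. Fext f (Fext g y) t + ?DN (C y) t + C (?DN y) t) = y" if y: "adm_BM y" for y
  proof -
    have "cone_pack degc (\<lambda>t. - ?DM (Fext g y) t + Fext g (?DN y) t)
        (\<lambda>t. Fext f (Fext g y) t + ?DN (C y) t + C (?DN y) t) = cone_pack degc (\<lambda>_. 0) y"
    proof
      fix t
      show "cone_pack degc (\<lambda>t. - ?DM (Fext g y) t + Fext g (?DN y) t)
        (\<lambda>t. Fext f (Fext g y) t + ?DN (C y) t + C (?DN y) t) t = cone_pack degc (\<lambda>_. 0) y t"
        using contr [OF adm_BM_cone_pack [OF adm_BM_zero y], of degc t]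
        by (simp add: DMext_cone H_Inr y adm F0 cone_pack_add)
    qed
    from cone_pack_eqD [OF this]
    show "(\<lambda>t. - ?DM (Fext g y) t + Fext g (?DN y) t) = (\<lambda>_. 0)"
      "(\<lambda>t. Fext f (Fext g y) t + ?DN (C y) t + C (?DN y) t) = y" .
  qed
  have "cobimod_map degc degn degm d dN dM g"
    unfolding cobimod_map_def
  proof (intro conjI allI impI g)
    fix y :: "'c list \<times> 'n \<times> 'c list \<Rightarrow> 'k" assume y: "adm_BM y"
    show "?DM (Fext g y) = Fext g (?DN y)"
    proof
      fix t show "?DM (Fext g y) t = Fext g (?DN y) t"
        using fun_cong [OF N_eqs(1) [OF y], of t] by simp
    qed
  qed
  moreover have "hom_comp_id adm_BM (tdeg degc degm) ?DM (Fext g) (Fext f)"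
    unfolding hom_comp_id_def
  proof (intro allI ballI)
    fix k x assume "x \<in> cycles adm_BM (tdeg degc degm) ?DM k"
    then have x: "adm_BM x" "homog (tdeg degc degm) k x" "?DM x = (\<lambda>_. 0)" by (auto simp: cycles_def)
    let ?z = "cone_pack degc x (\<lambda>_. 0) :: 'c list \<times> ('m + 'n) \<times> 'c list \<Rightarrow> 'k"
    have z: "adm_BM ?z" by (intro adm_BM_cone_pack x adm_BM_zero)
    \<comment> \<open>\<open>x\<close> has degree \<open>k - 1\<close> in the cone and its
      contraction degree \<open>k - 2\<close>; undoing the shift puts the \<open>M\<close> component
      in degree \<open>k - 1\<close>, right for a primitive in degree \<open>k\<close>.\<close>
    have "homog (tdeg degc ?deg) (k - 1) ?z" by (rule homog_cone_pack) (simp_all add: x)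
    then have Hz_hom: "homog (tdeg degc ?deg) (k - 1 + - 1) (bimod_ext degc 1 \<eta> ?z)"
      by (rule homog_bimod_ext) (simp add: \<eta>)
    have Hz_adm: "adm_BM (bimod_ext degc 1 \<eta> ?z)" by (intro adm_BM_bimod_ext z \<eta>)
    obtain a b where a: "adm_BM a" and b: "adm_BM b" and Hz: "bimod_ext degc 1 \<eta> ?z = cone_pack degc a b"
      and ab: "homog (tdeg degc ?deg) (k - 1 + - 1) (bimod_ext degc 1 \<eta> ?z)
        \<Longrightarrow> homog (tdeg degc degm) (k - 1 + - 1 + 1) a \<and> homog (tdeg degc degn) (k - 1 + - 1) b"
      using cone_unpack [OF Hz_adm, of degc] by metis
    \<comment> \<open>As \<open>x\<close> is a cycle, only \<open>F x\<close> remains, and the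
      contraction takes it to \<open>G (F x)\<close> in \<open>M\<close>. The \<open>M\<close>
      component of the identity thus makes \<open>a\<close> a primitive of
      \<open>G (F x) - x\<close>.\<close>
    have "?DK ?z = cone_pack degc (\<lambda>_. 0) (Fext f x)"
      by (simp add: DMext_cone x)
    then have "cone_pack degc (\<lambda>t. - ?DM a t + Fext g (Fext f x) t)
        (\<lambda>t. Fext f a t + ?DN b t + C (Fext f x) t) = ?z"
      using contr [OF z] by (intro ext) (simp add: Hz H_Inr DMext_cone a b x adm cone_pack_add)
    from cone_pack_eqD(1) [OF this] have "(\<lambda>t. - ?DM a t + Fext g (Fext f x) t) = x" .
    then have "(\<lambda>t. Fext g (Fext f x) t - x t) = ?DM a" by (auto simp: fun_eq_iff algebra_simps)
    then show "(\<lambda>t. Fext g (Fext f x) t - x t) \<in> bdries adm_BM (tdeg degc degm) ?DM k"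
      unfolding bdries_def using a ab [OF Hz_hom] by auto
  qed
  moreover have "hom_comp_id adm_BM (tdeg degc degn) ?DN (Fext f) (Fext g)"
    unfolding hom_comp_id_def
  proof (intro allI ballI)
    fix k y assume "y \<in> cycles adm_BM (tdeg degc degn) ?DN k"
    then have y: "adm_BM y" "homog (tdeg degc degn) k y" "?DN y = (\<lambda>_. 0)" by (auto simp: cycles_def)
    have "homog (tdeg degc degn) (k + - 1) (C y)"
      unfolding C_def by (rule homog_bimod_ext [OF y(2)]) (simp add: c)
    then have hom: "homog (tdeg degc degn) (k - 1) (\<lambda>t. - C y t)" by (simp add: homog_uminus)
    \<comment> \<open>On a cycle the term \<open>C (D^N y)\<close> drops out, and the remaining sign
      goes into the primitive.\<close>
    have "(\<lambda>t. Fext f (Fext g y) t - y t) = ?DN (\<lambda>t. - C y t)"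
    proof
      fix t show "Fext f (Fext g y) t - y t = ?DN (\<lambda>t. - C y t) t"
        using fun_cong [OF N_eqs(2) [OF y(1)], of t] by (simp add: y(3) C0 DMext_uminus algebra_simps)
    qed
    then show "(\<lambda>t. Fext f (Fext g y) t - y t) \<in> bdries adm_BM (tdeg degc degn) ?DN k"
      unfolding bdries_def using hom adm_BM_uminus [OF adm(5) [OF y(1)]] by blast
  qed
  ultimately show ?thesis by blast
qed

end
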